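(* For every $n\ge0$ (with the convention $e_{-1}=0$), $$Xe_n=e_{n+1}-\frac{n(n+1)}4e_n+\frac{n^2}{4n^2-1}\Big(c-\frac{n^2-1}4\Big)^2e_{n-1},$$ $$Ye_n=e_{n+1}+\frac{n(n+1)}4e_n+\frac{n^2}{4n^2-1}\Big(c-\frac{n^2-1}4\Big)^2e_{n-1},$$ $$Ue_n=\Big(c-\frac{n(n+1)}2\Big)e_n.$$
   Context: Let $x_1=\tfrac12\begin{pmatrix}0&1\\1&0\end{pmatrix}$, $x_2=\tfrac12\begin{pmatrix}0&-i\\ i&0\end{pmatrix}$, $x_3=\tfrac12\begin{pmatrix}1&0\\0&-1\end{pmatrix}$, $c=x_1^2+x_2^2+x_3^2$; for a chord diagram $D$ (oriented circle, $2n$ points paired into chords), $w_{\mathfrak{sl}_2}(D)=\sum_\varphi x_{\varphi(p_1)}\cdots x_{\varphi(p_{2n})}\in\mathbb C[c]$ ($p_i$ endpoints in order from a cut point, $\varphi$ over maps chords$\to\{1,2,3\}$). A share: two oriented intervals (strand 1, strand 2) with finitely many chords, up to orientation-preserving diffeomorphisms of each strand; arches have both ends on one strand, bridges one on each. $A_2$ = $\mathbb C$-span of shares; join $(I,H)$ = chord diagram whose circle reads strand 1 of $I$, strand 1 of $H$, strand 2 of $I$, strand 2 of $H$; $I\sim I'$ iff $w_{\mathfrak{sl}_2}((I,H))=w_{\mathfrak{sl}_2}((I',H))$ for all shares $H$; $\mathcal S=A_2/\!\sim$. Cross product $I\times H$: strand 1 = strand 1 of $I$ then strand 1 of $H$;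 strand 2 = strand 2 of $H$ then strand 2 of $I$; this makes $\mathcal S\cong\mathbb C[c][y]$, $c$ = class of a one-arch share, $y$ = class of the one-bridge share. Linear operators on $\mathcal S$ (induced from shares): $U$ adds an arch on strand 1 whose endpoints precede and follow all other endpoints on strand 1; $X$ adds a bridge from a point after all endpoints on strand 1 to a point after all endpoints on strand 2; $Y$ adds a bridge from a point after all endpoints on strand 1 to a point before all endpoints on strand 2. For $m\ge0$ let $u_m=c-\frac{m(m+1)}2$; $e_m\in\mathcal S$ denotes the unique element that is a monic polynomial of degree $m$ in $y$ over $\mathbb C[c]$ with $Ue_m=u_me_m$ (these exist and form a $\mathbb C[c]$-basis of $\mathcal S$). *)

theory Defs
  imports Complex_Main "HOL-Library.FuncSet" "HOL-Computational_Algebra.Polynomial"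
begin

text \<open>Elements of U(sl2) are handled through their actions on the irreducible
  representations V_k (dimension k+1, basis v_0..v_k). Matrices are functions
  nat => nat => complex, supported on indices 0..k.\<close>

definition mmul :: "nat \<Rightarrow> (nat \<Rightarrow> nat \<Rightarrow> complex) \<Rightarrow> (nat \<Rightarrow> nat \<Rightarrow> complex) \<Rightarrow> (nat \<Rightarrow> nat \<Rightarrow> complex)" where
  "mmul k A B = (\<lambda>r s. \<Sum>l\<le>k. A r l * B l s)"

definition idm :: "nat \<Rightarrow> nat \<Rightarrow> nat \<Rightarrow> complex" where
  "idm k = (\<lambda>r s. if r = s \<and> r \<le> k then 1 else 0)"

definition hm :: "nat \<Rightarrow> nat \<Rightarrow> nat \<Rightarrow> complex" where
  "hm k = (\<lambda>r s. if r = s \<and> r \<le> k then of_int (int k - 2 * int r) else 0)"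

definition em :: "nat \<Rightarrow> nat \<Rightarrow> nat \<Rightarrow> complex" where
  "em k = (\<lambda>r s. if s \<le> k \<and> r + 1 = s then of_nat (s * (k - s + 1)) else 0)"

definition fm :: "nat \<Rightarrow> nat \<Rightarrow> nat \<Rightarrow> complex" where
  "fm k = (\<lambda>r s. if r \<le> k \<and> r = s + 1 then 1 else 0)"

text \<open>x_1 = (e+f)/2, x_2 = i(f-e)/2, x_3 = h/2 acting on V_k; for k = 1 these are
  exactly the 2x2 matrices of the paper.\<close>
definition rho :: "nat \<Rightarrow> nat \<Rightarrow> nat \<Rightarrow> nat \<Rightarrow> complex" where
  "rho k i = (if i = 1 then (\<lambda>r s. (em k r s + fm k r s) / 2)
              else if i = 2 then (\<lambda>r s. \<i> * (fm k r s - em k r s) / 2)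
              else (\<lambda>r s. hm k r s / 2))"

text \<open>A chord diagram: the word of chord labels read along the circle from a cut point;
  each label occurs exactly twice.\<close>
type_synonym chord_diagram = "nat list"

definition wk :: "nat \<Rightarrow> chord_diagram \<Rightarrow> nat \<Rightarrow> nat \<Rightarrow> complex" where
  "wk k D = (\<lambda>r s. \<Sum>\<phi> \<in> PiE (set D) (\<lambda>_. {1,2,3::nat}).
               foldr (\<lambda>l M. mmul k (rho k (\<phi> l)) M) D (idm k) r s)"

text \<open>Casimir c acts on V_k by k(k+2)/4; w_sl2(D) is the polynomial p in c with
  w(D) = p(c), i.e. acting on each V_k as p(k(k+2)/4).\<close>
definition cas :: "nat \<Rightarrow> complex" where
  "cas k = of_nat k * (of_nat k + 2) / 4"

definition w_sl2 :: "chord_diagram \<Rightarrow> complex poly" where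
  "w_sl2 D = (THE p. \<forall>k. wk k D = (\<lambda>r s. poly p (cas k) * idm k r s))"

type_synonym share = "nat list \<times> nat list"

definition is_share :: "share \<Rightarrow> bool" where
  "is_share S = (\<forall>l \<in> set (fst S @ snd S). count_list (fst S @ snd S) l = 2)"

definition join :: "share \<Rightarrow> share \<Rightarrow> chord_diagram" where
  "join I H = map (\<lambda>l. 2*l) (fst I) @ map (\<lambda>l. 2*l+1) (fst H)
            @ map (\<lambda>l. 2*l) (snd I) @ map (\<lambda>l. 2*l+1) (snd H)"

text \<open>Elements of A_2: finite formal linear combinations of shares.\<close>
type_synonym A2 = "(complex \<times> share) list"

definition wlin :: "A2 \<Rightarrow> share \<Rightarrow> complex poly" where
  "wlin L H = (\<Sum>(a, I) \<leftarrow> L. smult a (w_sl2 (join I H)))"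

definition share_sim :: "A2 \<Rightarrow> A2 \<Rightarrow> bool" (infix "\<sim>\<^sub>S" 50) where
  "L \<sim>\<^sub>S L' \<longleftrightarrow> (\<forall>H. is_share H \<longrightarrow> wlin L H = wlin L' H)"

definition fresh :: "share \<Rightarrow> nat" where
  "fresh S = Suc (Max (insert 0 (set (fst S @ snd S))))"

definition opU1 :: "share \<Rightarrow> share" where
  "opU1 S = (let N = fresh S in ([N] @ fst S @ [N], snd S))"

definition opX1 :: "share \<Rightarrow> share" where
  "opX1 S = (let N = fresh S in (fst S @ [N], snd S @ [N]))"

definition opY1 :: "share \<Rightarrow> share" where
  "opY1 S = (let N = fresh S in (fst S @ [N], N # snd S))"

definition linop :: "(share \<Rightarrow> share) \<Rightarrow> A2 \<Rightarrow> A2" where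
  "linop f L = map (\<lambda>(a, I). (a, f I)) L"

definition opU :: "A2 \<Rightarrow> A2" where "opU = linop opU1"
definition opX :: "A2 \<Rightarrow> A2" where "opX = linop opX1"
definition opY :: "A2 \<Rightarrow> A2" where "opY = linop opY1"

text \<open>Outer variable y, coefficients in C[c]. The monomial c^i y^j corresponds to the
  cross product of i one-arch shares and j one-bridge shares.\<close>
definition mono :: "nat \<Rightarrow> nat \<Rightarrow> share" where
  "mono i j = (concat (map (\<lambda>l. [l, l]) [0..<i]) @ [i..<i+j], rev [i..<i+j])"

definition rep :: "complex poly poly \<Rightarrow> A2" where
  "rep P = concat (map (\<lambda>j. map (\<lambda>i. (coeff (coeff P j) i, mono i j))
                                [0..<Suc (degree (coeff P j))]) [0..<Suc (degree P)])"

definition c_minus :: "complex \<Rightarrow> complex poly" where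
  "c_minus t = [:- t, 1:]"

definition u :: "nat \<Rightarrow> complex poly" where
  "u m = c_minus (of_nat (m * (m + 1)) / 2)"

definition e :: "nat \<Rightarrow> complex poly poly" where
  "e m = (THE P. degree P = m \<and> lead_coeff P = 1 \<and> opU (rep P) \<sim>\<^sub>S rep (smult (u m) P))"

definition e_prev :: "nat \<Rightarrow> complex poly poly" where
  "e_prev n = (if n = 0 then 0 else e (n - 1))"

definition coefK :: "nat \<Rightarrow> complex poly" where
  "coefK n = smult (of_nat (n^2) / (4 * of_nat (n^2) - 1)) ((c_minus ((of_nat (n^2) - 1) / 4))^2)"

end

theory Submission
  imports Defs
begin

text \<open>
  A share \<open>I\<close> acts on \<open>End V\<^sub>k\<close> by \<open>M \<mapsto> \<Sum>\<^sub>\<phi> A\<^sub>\<phi> M B\<^sub>\<phi>\<close>, where \<open>A\<^sub>\<phi>\<close> and \<open>B\<^sub>\<phi>\<close> are the products along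
  its two strands. This map \<open>T\<close> commutes with the adjoint action, and the weight of a join is
  obtained by applying it to strand 1 of the other share and multiplying by strand 2. A product
  of bridges acts by powers of \<open>y M = \<Sum>\<^sub>j x\<^sub>j M x\<^sub>j\<close>, and the operators become
  \<open>Y T = T \<circ> y\<close>, \<open>U T = (M \<mapsto> \<Sum>\<^sub>j x\<^sub>j T (x\<^sub>j M))\<close> and \<open>X T = (M \<mapsto> \<Sum>\<^sub>j T (x\<^sub>j M) x\<^sub>j)\<close>.

  Equivariance of \<open>T\<close> gives \<open>X = U + Y - c\<close>. Since \<open>y\<close> is \<open>c\<close> minus half the adjoint Casimir operator,
  the double commutator identity for vector operators yields
  \<open>Y\<^sup>2 U - 2 Y U Y + U Y\<^sup>2 = 2 c U + 2 c Y - U Y - Y U - Y\<^sup>2 - c\<^sup>2\<close>. With \<open>U 1 = c\<close> and \<open>U y = (c - 1) y\<close> this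
  shows by induction that the polynomials defined by the claimed three-term recurrence for \<open>Y\<close> are
  eigenvectors of \<open>U\<close>. They are the only monic ones because no nonzero polynomial in \<open>y\<close> pairs to zero with
  all shares: the null space is stable under \<open>U\<close>, so it would contain a nonzero multiple of some eigenvector, whose
  pairing with the empty share is its value at \<open>y = c\<close>, a nonzero polynomial.
\<close>

section \<open>The representations of sl2 as one ring\<close>

text \<open>An element of this ring is a family of endomorphisms, one of each \<open>V\<^sub>k\<close>. Treating all \<open>k\<close> at once
  makes it an algebra over \<open>\<complex>[c]\<close> in which \<open>w_sl2\<close> can be read off as a central element.\<close>

typedef rep_family =
  "{A :: nat \<Rightarrow> nat \<Rightarrow> nat \<Rightarrow> complex. \<forall>k r s. k < r \<or> k < s \<longrightarrow> A k r s = 0}"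
  by (rule exI[of _ "\<lambda>_ _ _. 0"]) simp

lemma mmul_scalar:
  "mmul k (\<lambda>r s. z * idm k r s) A r s = (if r \<le> k then z * A r s else 0)"
  "mmul k A (\<lambda>r s. z * idm k r s) r s = (if s \<le> k then z * A r s else 0)"
proof -
  have "mmul k (\<lambda>r s. z * idm k r s) A r s
      = (\<Sum>l\<le>k. if l = r then (if r \<le> k then z * A r s else 0) else 0)"
    unfolding mmul_def idm_def by (intro sum.cong) auto
  thus "mmul k (\<lambda>r s. z * idm k r s) A r s = (if r \<le> k then z * A r s else 0)" by auto
  have "mmul k A (\<lambda>r s. z * idm k r s) r s
      = (\<Sum>l\<le>k. if l = s then (if s \<le> k then z * A r s else 0) else 0)"
    unfolding mmul_def idm_def by (intro sum.cong) auto
  thus "mmul k A (\<lambda>r s. z * idm k r s) r s = (if s \<le> k then z * A r s else 0)" by auto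
qed

setup_lifting type_definition_rep_family

instantiation rep_family :: ring_1
begin

lift_definition zero_rep_family :: rep_family is "\<lambda>_ _ _. 0" by simp

lift_definition one_rep_family :: rep_family is idm by (auto simp: idm_def)

lift_definition plus_rep_family :: "rep_family \<Rightarrow> rep_family \<Rightarrow> rep_family"
  is "\<lambda>A B k r s. A k r s + B k r s" by simp

lift_definition minus_rep_family :: "rep_family \<Rightarrow> rep_family \<Rightarrow> rep_family"
  is "\<lambda>A B k r s. A k r s - B k r s" by simp

lift_definition uminus_rep_family :: "rep_family \<Rightarrow> rep_family"
  is "\<lambda>A k r s. - A k r s" by simp

lift_definition times_rep_family :: "rep_family \<Rightarrow> rep_family \<Rightarrow> rep_family"
  is "\<lambda>A B k. mmul k (A k) (B k)" by (auto simp: mmul_def)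

instance
proof
  fix a b c :: rep_family
  show "a * b * c = a * (b * c)"
  proof transfer
    fix a b c :: "nat \<Rightarrow> nat \<Rightarrow> nat \<Rightarrow> complex"
    show "(\<lambda>k. mmul k (mmul k (a k) (b k)) (c k)) = (\<lambda>k. mmul k (a k) (mmul k (b k) (c k)))"
      unfolding mmul_def sum_distrib_left sum_distrib_right
      by (intro ext, subst sum.swap) (simp add: mult.assoc)
  qed
  show "1 * a = a"
    by transfer (use mmul_scalar(1)[where z=1] in \<open>auto simp: fun_eq_iff not_le\<close>)
  show "a * 1 = a"
    by transfer (use mmul_scalar(2)[where z=1] in \<open>auto simp: fun_eq_iff not_le\<close>)
  show "(0::rep_family) \<noteq> 1" by transfer (auto simp: idm_def fun_eq_iff)
qed (transfer; auto simp: mmul_def fun_eq_iff algebra_simps sum.distrib)+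

end

lift_definition gen :: "nat \<Rightarrow> rep_family" is "\<lambda>i k. rho k i"
  by (auto simp: rho_def em_def fm_def hm_def)

text \<open>The central element \<open>p(c)\<close>: the Casimir acts on the \<open>k\<close>-th
  module by \<open>cas k\<close>. This embeds the coefficient ring in the centre and also stands in
  for scalar multiplication, since \<open>rep_family\<close> is only given a ring structure.\<close>

lift_definition scal :: "complex poly \<Rightarrow> rep_family" is "\<lambda>p k r s. poly p (cas k) * idm k r s"
  by (auto simp: idm_def)

lemma scal_add: "scal (p + q) = scal p + scal q"
  by transfer (simp add: fun_eq_iff algebra_simps)

lemma scal_diff: "scal (p - q) = scal p - scal q"
  by transfer (simp add: fun_eq_iff algebra_simps)

lemma scal_0 [simp]: "scal 0 = 0"
  by transfer (simp add: fun_eq_iff)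

lemma scal_1 [simp]: "scal 1 = 1"
  by transfer (simp add: fun_eq_iff)

lemma rep_scal_times: "Rep_rep_family (scal p * a) k r s = poly p (cas k) * Rep_rep_family a k r s"
  by transfer (auto simp: mmul_scalar)

lemma rep_times_scal: "Rep_rep_family (a * scal p) k r s = poly p (cas k) * Rep_rep_family a k r s"
  by transfer (auto simp: mmul_scalar)

lemma rep_family_eqI: "(\<And>k r s. Rep_rep_family a k r s = Rep_rep_family b k r s) \<Longrightarrow> a = b"
  by (metis Rep_rep_family_inject ext)

lemma scal_commute: "a * scal p = scal p * a"
  by (rule rep_family_eqI) (simp add: rep_scal_times rep_times_scal)

lemma scal_left_commute: "a * (scal p * b) = scal p * (a * b)"
  by (metis mult.assoc scal_commute)

lemma scal_mult: "scal (p * q) = scal p * scal q"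
  by (rule rep_family_eqI) (simp add: rep_scal_times scal.rep_eq)

text \<open>\<open>k * (k + 2)\<close> is strictly increasing, so the Casimir takes infinitely many
  values. A polynomial in \<open>c\<close> is therefore determined by its action on all
  modules.\<close>

lemma inj_cas: "inj cas"
proof (rule injI)
  fix j k assume "cas j = cas k"
  moreover have "of_nat (i * (i + 2)) = 4 * cas i" for i by (simp add: cas_def algebra_simps)
  ultimately have "of_nat (j * (j + 2)) = (of_nat (k * (k + 2)) :: complex)" by simp
  hence *: "j * (j + 2) = k * (k + 2)" using of_nat_eq_iff by blast
  show "j = k"
    using mult_strict_mono[of j k "j+2" "k+2"] mult_strict_mono[of k j "k+2" "j+2"] *
    by (cases j k rule: linorder_cases) auto
qed

lemma poly_eqI_infinite:
  fixes p q :: "complex poly"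
  assumes "infinite X" "\<And>x. x \<in> X \<Longrightarrow> poly p x = poly q x"
  shows "p = q"
proof (rule ccontr)
  assume "p \<noteq> q"
  hence "finite {x. poly (p - q) x = 0}" by (intro poly_roots_finite) simp
  moreover have "X \<subseteq> {x. poly (p - q) x = 0}" using assms(2) by auto
  ultimately show False using assms(1) finite_subset by blast
qed

lemma scal_inject: "scal p = scal q \<longleftrightarrow> p = q"
proof
  assume "scal p = scal q"
  hence "poly p (cas k) = poly q (cas k)" for k
    by (auto simp: idm_def scal.rep_eq dest: arg_cong[of _ _ "\<lambda>a. Rep_rep_family a k 0 0"])
  thus "p = q"
    using inj_cas by (intro poly_eqI_infinite[of "range cas"]) (auto dest: range_inj_infinite)
qed simp

abbreviation imu :: rep_family where "imu \<equiv> scal [:\<i>:]"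

abbreviation casimir :: rep_family where "casimir \<equiv> scal [:0, 1:]"

lemma imu_square: "imu * imu = - 1"
proof -
  have "imu * imu = scal (- 1)" by (simp flip: scal_mult add: one_pCons)
  also have "\<dots> = - 1" using scal_diff[of 0 1] by simp
  finally show ?thesis .
qed

section \<open>Commutation relations of sl2 and the Casimir element\<close>

lemma em_altdef:
  "em k r s = (if s \<le> k \<and> r + 1 = s then of_nat s * (of_nat k - of_nat r) else 0)"
proof (cases "s \<le> k \<and> r + 1 = s")
  case True
  hence "k - s + 1 = k - r" "r \<le> k" by auto
  with True show ?thesis unfolding em_def by (simp only: of_nat_mult of_nat_diff if_True simp_thms)
qed (auto simp: em_def)

text \<open>Each row of the three matrices has at most one nonzero entry. For \<open>r = k\<close>
  the raising matrix would reach row \<open>k + 1\<close> of \<open>A\<close>, which lies outside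
  the sum; there the factor \<open>k - r\<close> vanishes, so the formula needs no case
  distinction.\<close>

lemma mmul_gen_row:
  assumes "r \<le> k"
  shows "mmul k (em k) A r s = of_nat (r + 1) * (of_nat k - of_nat r) * A (r + 1) s"
    and "mmul k (fm k) A r s = (if r = 0 then 0 else A (r - 1) s)"
    and "mmul k (hm k) A r s = (of_nat k - 2 * of_nat r) * A r s"
proof -
  have "mmul k (em k) A r s
      = (\<Sum>l\<le>k. if l = r + 1 then of_nat (r + 1) * (of_nat k - of_nat r) * A (r + 1) s else 0)"
    unfolding mmul_def em_altdef by (intro sum.cong) auto
  thus "mmul k (em k) A r s = of_nat (r + 1) * (of_nat k - of_nat r) * A (r + 1) s"
    using assms by auto
  have "mmul k (fm k) A r s = (\<Sum>l\<le>k. if l = r - 1 then (if r = 0 then 0 else A (r - 1) s) else 0)"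
    unfolding mmul_def fm_def using assms by (intro sum.cong) auto
  thus "mmul k (fm k) A r s = (if r = 0 then 0 else A (r - 1) s)"
    using assms by auto
  have "mmul k (hm k) A r s = (\<Sum>l\<le>k. if l = r then (of_nat k - 2 * of_nat r) * A r s else 0)"
    unfolding mmul_def hm_def using assms by (intro sum.cong) auto
  thus "mmul k (hm k) A r s = (of_nat k - 2 * of_nat r) * A r s"
    using assms by auto
qed

lift_definition raise :: rep_family is em by (auto simp: em_def)
lift_definition lower :: rep_family is fm by (auto simp: fm_def)
lift_definition weight :: rep_family is hm by (auto simp: hm_def)

lemma rep_family_eqI':
  assumes "\<And>k r s. r \<le> k \<Longrightarrow> Rep_rep_family a k r s = Rep_rep_family b k r s"
  shows "a = b"
proof (rule rep_family_eqI)
  fix k r s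
  show "Rep_rep_family a k r s = Rep_rep_family b k r s"
    using assms[of r k s] Rep_rep_family[of a] Rep_rep_family[of b] by (cases "r \<le> k") auto
qed

lemmas rep_family_rep_eq =
  zero_rep_family.rep_eq one_rep_family.rep_eq plus_rep_family.rep_eq minus_rep_family.rep_eq
  uminus_rep_family.rep_eq times_rep_family.rep_eq scal.rep_eq gen.rep_eq
  raise.rep_eq lower.rep_eq weight.rep_eq

lemma raise_lower: "raise * lower - lower * raise = weight"
  by (rule rep_family_eqI', simp add: rep_family_rep_eq mmul_gen_row)
     (auto simp: em_altdef fm_def hm_def algebra_simps not_less_eq_eq dest: le_antisym)

lemma weight_raise: "weight * raise - raise * weight = raise + raise"
  by (rule rep_family_eqI', simp add: rep_family_rep_eq mmul_gen_row)
     (auto simp: em_altdef fm_def hm_def algebra_simps)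

lemma weight_lower: "weight * lower - lower * weight = - (lower + lower)"
  by (rule rep_family_eqI', simp add: rep_family_rep_eq mmul_gen_row)
     (auto simp: em_altdef fm_def hm_def algebra_simps)

abbreviation half :: rep_family where "half \<equiv> scal [:1/2:]"

lemma half_add: "half * a + half * a = a"
  by (simp flip: distrib_right scal_add add: one_pCons[symmetric])

lemma gen_eq:
  "gen 1 = half * (raise + lower)"
  "gen 2 = half * (imu * (lower - raise))"
  "gen 3 = half * weight"
  by (rule rep_family_eqI, simp add: rep_scal_times gen.rep_eq rho_def raise.rep_eq lower.rep_eq
      weight.rep_eq plus_rep_family.rep_eq minus_rep_family.rep_eq)+


text \<open>On the basis vector of index \<open>r\<close> the two products contribute
  \<open>(r + 1) * (k - r)\<close> and \<open>r * (k - r + 1)\<close>. Half their sum plus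
  \<open>(k - 2 * r)^2 / 4\<close> is \<open>k * (k + 2) / 4\<close>, independently of
  \<open>r\<close>.\<close>

lemma casimir_raise_lower:
  "casimir = half * (raise * lower + lower * raise) + half * (half * (weight * weight))"
  by (rule rep_family_eqI', simp only: plus_rep_family.rep_eq rep_scal_times,
      simp add: rep_family_rep_eq mmul_gen_row)
     (auto simp: em_altdef fm_def hm_def cas_def idm_def field_simps not_less_eq_eq dest: le_antisym)

lemmas scal_comms =
  scal_commute[of raise] scal_commute[of lower] scal_commute[of weight] scal_commute[of imu "[:1/2:]"]
  scal_left_commute[of raise] scal_left_commute[of lower] scal_left_commute[of weight]
  scal_left_commute[of imu "[:1/2:]"]

lemma imu_imu: "imu * (imu * a) = - a"
  by (simp add: imu_square flip: mult.assoc)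

lemma imu_gen3: "gen 1 * gen 2 - gen 2 * gen 1 = imu * gen 3"
proof -
  have "gen 1 * gen 2 - gen 2 * gen 1 = (half + half) * (half * (imu * (raise * lower - lower * raise)))"
    unfolding gen_eq by (simp add: algebra_simps scal_comms)
  thus ?thesis using half_add[of 1]
    unfolding raise_lower gen_eq by (simp add: scal_comms)
qed

lemma imu_gen1: "gen 2 * gen 3 - gen 3 * gen 2 = imu * gen 1"
proof -
  have "gen 2 * gen 3 - gen 3 * gen 2
    = half * (half * (imu * ((weight * raise - raise * weight) - (weight * lower - lower * weight))))"
    unfolding gen_eq by (simp add: algebra_simps scal_comms)
  also have "\<dots> = (half + half) * (imu * (half * (raise + lower)))"
    unfolding weight_raise weight_lower by (simp add: algebra_simps scal_comms)
  finally show ?thesis using half_add[of 1] unfolding gen_eq by simp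
qed

lemma imu_gen2: "gen 3 * gen 1 - gen 1 * gen 3 = imu * gen 2"
proof -
  have "gen 3 * gen 1 - gen 1 * gen 3
    = half * (half * ((weight * raise - raise * weight) + (weight * lower - lower * weight)))"
    unfolding gen_eq by (simp add: algebra_simps scal_comms)
  also have "\<dots> = (half + half) * (half * (raise - lower))"
    unfolding weight_raise weight_lower by (simp add: algebra_simps scal_comms)
  also have "\<dots> = half * (raise - lower)" using half_add[of 1] by simp
  also have "\<dots> = imu * gen 2" unfolding gen_eq by (simp add: scal_comms imu_imu algebra_simps)
  finally show ?thesis .
qed

lemma casimir_eq: "gen 1 * gen 1 + gen 2 * gen 2 + gen 3 * gen 3 = casimir"
proof -
  have "gen 1 * gen 1 + gen 2 * gen 2
    = (half + half) * (half * (raise * lower + lower * raise))"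
    unfolding gen_eq by (simp add: algebra_simps scal_comms imu_imu)
  moreover have "gen 3 * gen 3 = half * (half * (weight * weight))"
    unfolding gen_eq by (simp add: algebra_simps scal_comms)
  ultimately show ?thesis using half_add[of 1] casimir_raise_lower by simp
qed

section \<open>Sums over colourings and invariance\<close>

definition colsum :: "nat set \<Rightarrow> ((nat \<Rightarrow> nat) \<Rightarrow> 'a::comm_monoid_add) \<Rightarrow> 'a" where
  "colsum S G = (\<Sum>\<phi> \<in> PiE S (\<lambda>_. {1,2,3}). G \<phi>)"

text \<open>Colourings are total functions, extensional outside the chord set. Sums over different
  chord sets can only be compared for summands that ignore the colours of all other labels.\<close>

definition depends_on :: "((nat \<Rightarrow> nat) \<Rightarrow> 'a) \<Rightarrow> nat set \<Rightarrow> bool" where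
  "depends_on G S \<longleftrightarrow> (\<forall>\<phi> \<phi>'. (\<forall>l\<in>S. \<phi> l = \<phi>' l) \<longrightarrow> G \<phi> = G \<phi>')"

lemma depends_onD: "depends_on G S \<Longrightarrow> (\<And>l. l \<in> S \<Longrightarrow> \<phi> l = \<phi>' l) \<Longrightarrow> G \<phi> = G \<phi>'"
  unfolding depends_on_def by blast

lemma depends_on_upd:
  "depends_on G (insert l S) \<Longrightarrow> depends_on (\<lambda>\<phi>. G (\<phi>(l := j))) S"
  unfolding depends_on_def by simp

lemma colsum_empty: "colsum {} G = G (\<lambda>_. undefined)"
  unfolding colsum_def by simp

lemma colsum_insert:
  assumes "l \<notin> S"
  shows "colsum (insert l S) G = (\<Sum>j\<in>{1,2,3}. colsum S (\<lambda>\<phi>. G (\<phi>(l := j))))"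
proof -
  let ?J = "{1,2,3::nat}"
  have "colsum (insert l S) G = (\<Sum>(j, \<phi>) \<in> ?J \<times> PiE S (\<lambda>_. ?J). G (\<phi>(l := j)))"
    unfolding colsum_def PiE_insert_eq
    by (subst sum.reindex) (use inj_combinator[OF assms, of "\<lambda>_. ?J"] in \<open>auto simp: case_prod_unfold\<close>)
  thus ?thesis unfolding colsum_def by (simp only: sum.cartesian_product)
qed

lemma colsum_cong: "(\<And>\<phi>. G \<phi> = H \<phi>) \<Longrightarrow> colsum S G = colsum S H"
  unfolding colsum_def by simp

lemma colsum_add: "colsum S (\<lambda>\<phi>. G \<phi> + H \<phi>) = colsum S G + colsum S H"
  unfolding colsum_def by (rule sum.distrib)

lemma colsum_diff:
  "colsum S (\<lambda>\<phi>. G \<phi> - H \<phi>) = colsum S G - (colsum S H :: 'a::ab_group_add)"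
  unfolding colsum_def by (rule sum_subtractf)

lemma colsum_mult_left: "a * colsum S G = colsum S (\<lambda>\<phi>. a * G \<phi> :: 'a::ring)"
  unfolding colsum_def by (rule sum_distrib_left)

lemma colsum_mult_right: "colsum S G * a = colsum S (\<lambda>\<phi>. G \<phi> * a :: 'a::ring)"
  unfolding colsum_def by (rule sum_distrib_right)

lemma colsum_sum: "(\<Sum>j\<in>J. colsum S (G j)) = colsum S (\<lambda>\<phi>. \<Sum>j\<in>J. G j \<phi>)"
  unfolding colsum_def by (rule sum.swap)

text \<open>The two arguments of \<open>G\<close> separate the two roles of one colouring: the first
  counts only on \<open>S\<close>, the second only on \<open>S'\<close>. Disjointness then turns the
  sum over the union into an iterated sum.\<close>

lemma colsum_union:
  assumes "finite S" "S \<inter> S' = {}"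
    and "\<And>\<psi>. depends_on (\<lambda>\<phi>. G \<phi> \<psi>) S" "\<And>\<phi>. depends_on (G \<phi>) S'"
  shows "colsum (S \<union> S') (\<lambda>\<phi>. G \<phi> \<phi>) = colsum S (\<lambda>\<phi>. colsum S' (G \<phi>))"
  using assms
proof (induction S arbitrary: G rule: finite_induct)
  case empty
  have "G \<phi> \<phi> = G (\<lambda>_. undefined) \<phi>" for \<phi>
    by (rule depends_onD[OF empty(2)]) simp
  thus ?case by (simp add: colsum_empty)
next
  case (insert l S)
  have l: "l \<notin> S \<union> S'" using insert by auto
  have "colsum (insert l S \<union> S') (\<lambda>\<phi>. G \<phi> \<phi>)
      = (\<Sum>j\<in>{1,2,3}. colsum (S \<union> S') (\<lambda>\<phi>. G (\<phi>(l := j)) (\<phi>(l := j))))"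
    using colsum_insert[OF l] by simp
  also have "\<dots> = (\<Sum>j\<in>{1,2,3}. colsum (S \<union> S') (\<lambda>\<phi>. G (\<phi>(l := j)) \<phi>))"
    using l by (intro sum.cong colsum_cong depends_onD[OF insert.prems(3)]) auto
  also have "\<dots> = (\<Sum>j\<in>{1,2,3}. colsum S (\<lambda>\<phi>. colsum S' (G (\<phi>(l := j)))))"
    using insert.prems by (intro sum.cong refl insert.IH depends_on_upd) auto
  also have "\<dots> = colsum (insert l S) (\<lambda>\<phi>. colsum S' (G \<phi>))"
    unfolding colsum_insert[OF insert.hyps(2)] ..
  finally show ?case .
qed

lemma colsum_image:
  assumes "finite S" "inj f" "depends_on G S"
  shows "colsum (f ` S) (\<lambda>\<phi>. G (\<phi> \<circ> f)) = colsum S G"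
  using assms
proof (induction S arbitrary: G rule: finite_induct)
  case empty
  show ?case using depends_onD[OF empty(2)] by (simp add: colsum_empty)
next
  case (insert l S)
  have upd: "\<phi>(f l := j) \<circ> f = (\<phi> \<circ> f)(l := j)" for \<phi> :: "nat \<Rightarrow> nat" and j
    using \<open>inj f\<close> by (auto simp: fun_eq_iff dest: injD)
  have fl: "f l \<notin> f ` S" using insert.hyps(2) \<open>inj f\<close> by (auto dest: injD)
  have "colsum (f ` insert l S) (\<lambda>\<phi>. G (\<phi> \<circ> f))
      = (\<Sum>j\<in>{1,2,3}. colsum (f ` S) (\<lambda>\<phi>. G ((\<phi> \<circ> f)(l := j))))"
    using colsum_insert[OF fl, of "\<lambda>\<phi>. G (\<phi> \<circ> f)"] by (simp add: upd)
  also have "\<dots> = (\<Sum>j\<in>{1,2,3}. colsum S (\<lambda>\<phi>. G (\<phi>(l := j))))"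
    using insert.prems by (intro sum.cong refl insert.IH depends_on_upd)
  also have "\<dots> = colsum (insert l S) G"
    using colsum_insert[OF insert.hyps(2), of G] by simp
  finally show ?case .
qed

section \<open>Products along strands, the map of a share and its equivariance\<close>

definition word :: "(nat \<Rightarrow> nat) \<Rightarrow> nat list \<Rightarrow> rep_family" where
  "word \<phi> D = prod_list (map (\<lambda>l. gen (\<phi> l)) D)"

lemma word_simps [simp]:
  "word \<phi> [] = 1" "word \<phi> (l # D) = gen (\<phi> l) * word \<phi> D" "word \<phi> (D @ D') = word \<phi> D * word \<phi> D'"
  by (simp_all add: word_def)

lemma word_map: "word \<phi> (map f D) = word (\<phi> \<circ> f) D"
  by (simp add: word_def comp_def)

lemma word_cong: "(\<And>l. l \<in> set D \<Longrightarrow> \<phi> l = \<psi> l) \<Longrightarrow> word \<phi> D = word \<psi> D"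
  unfolding word_def by (simp cong: map_cong)

lemma word_upd [simp]: "l \<notin> set D \<Longrightarrow> word (\<phi>(l := j)) D = word \<phi> D"
  by (rule word_cong) auto

definition transfer_op :: "share \<Rightarrow> rep_family \<Rightarrow> rep_family" where
  "transfer_op I P = colsum (set (fst I) \<union> set (snd I)) (\<lambda>\<phi>. word \<phi> (fst I) * P * word \<phi> (snd I))"

text \<open>The Leibniz expansion: the sum over all positions of the product of the
  \<open>f l\<close> in which the factor at that position is replaced by \<open>g l\<close>.\<close>

primrec dprod :: "('b \<Rightarrow> 'a::ring_1) \<Rightarrow> ('b \<Rightarrow> 'a) \<Rightarrow> 'b list \<Rightarrow> 'a" where
  "dprod f g [] = 0"
| "dprod f g (l # D) = g l * prod_list (map f D) + f l * dprod f g D"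

lemma dprod_append:
  "dprod f g (D @ D') = dprod f g D * prod_list (map f D') + prod_list (map f D) * dprod f g D'"
  by (induction D) (simp_all add: algebra_simps)

lemma commutator_prod_list:
  "x * prod_list (map f D) - prod_list (map f D) * x = dprod f (\<lambda>l. x * f l - f l * x) D"
  for x :: "'a::ring_1"
proof (induction D)
  case (Cons l D)
  have "x * prod_list (map f (l # D)) - prod_list (map f (l # D)) * x
      = (x * f l - f l * x) * prod_list (map f D)
        + f l * (x * prod_list (map f D) - prod_list (map f D) * x)"
    by (simp add: algebra_simps)
  thus ?case using Cons by simp
qed simp

lemma dprod_cong:
  "(\<And>l. l \<in> set D \<Longrightarrow> f l = f' l) \<Longrightarrow> (\<And>l. l \<in> set D \<Longrightarrow> g l = g' l) \<Longrightarrow> dprod f g D = dprod f' g' D"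
  by (induction D) (simp_all cong: map_cong)

lemma dprod_add: "dprod f (\<lambda>l. g l + g' l) D = dprod f g D + dprod f g' D"
  by (induction D) (simp_all add: algebra_simps)

lemma dprod_zero: "(\<And>l. l \<in> set D \<Longrightarrow> g l = 0) \<Longrightarrow> dprod f g D = 0"
  by (induction D) auto

lemma dprod_twice:
  assumes "l \<notin> set A" "l \<notin> set B" "l \<notin> set C"
  shows "dprod f (\<lambda>m. if m = l then a else 0) (A @ l # B @ l # C)
    = prod_list (map f A) * (a * prod_list (map f B) * f l + f l * prod_list (map f B) * a)
      * prod_list (map f C)"
proof -
  have "dprod f (\<lambda>m. if m = l then a else 0) E = 0" if "l \<notin> set E" for E
    using that by (intro dprod_zero) auto
  thus ?thesis using assms
    by (simp add: dprod_append distrib_left distrib_right mult.assoc)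
qed

lemma count_list_2_split:
  assumes "count_list D l = 2"
  obtains A B C where "D = A @ l # B @ l # C" "l \<notin> set A" "l \<notin> set B" "l \<notin> set C"
proof -
  have "l \<in> set D" using assms by (metis count_notin zero_neq_numeral)
  then obtain A R where D: "D = A @ l # R" "l \<notin> set A" by (meson split_list_first)
  have R: "count_list R l = 1" using assms D by simp
  hence "l \<in> set R" by (metis count_notin zero_neq_one)
  then obtain B C where BC: "R = B @ l # C" "l \<notin> set B" by (meson split_list_first)
  hence "count_list C l = 0" using R by simp
  thus thesis using that D BC by (simp add: count_list_0_iff)
qed

text \<open>Invariance of the tensor that a chord stands for: by antisymmetry of the structure
  constants, the terms from its two ends cancel in pairs.\<close>

lemma chord_invariant:
  assumes "i \<in> {1,2,3}"
  shows "(\<Sum>j\<in>{1,2,3}. (gen i * gen j - gen j * gen i) * P * gen j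
                     + gen j * P * (gen i * gen j - gen j * gen i)) = 0"
proof -
  have comm: "gen 2 * gen 1 - gen 1 * gen 2 = - (imu * gen 3)"
    "gen 3 * gen 2 - gen 2 * gen 3 = - (imu * gen 1)"
    "gen 1 * gen 3 - gen 3 * gen 1 = - (imu * gen 2)"
    unfolding imu_gen1[symmetric] imu_gen2[symmetric] imu_gen3[symmetric] by simp_all
  have sum3: "(\<Sum>j\<in>{1,2,3::nat}. f j) = f 1 + f 2 + f 3" for f :: "nat \<Rightarrow> rep_family"
    by (simp add: add.assoc)
  consider "i = 1" | "i = 2" | "i = 3" using assms by auto
  thus ?thesis
    by cases (simp_all only: sum3 comm imu_gen1 imu_gen2 imu_gen3 diff_self mult_zero_left mult_zero_right
      mult_minus_left mult_minus_right mult.assoc scal_left_commute, simp_all)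
qed

text \<open>Letters in \<open>S\<close> are coloured chords, all others carry a fixed element given
  by \<open>\<eta>\<close>. An induction can thus release chords from \<open>S\<close> one at a
  time, and a letter can stand for an arbitrary ring element.\<close>

definition assign :: "nat set \<Rightarrow> (nat \<Rightarrow> rep_family) \<Rightarrow> (nat \<Rightarrow> nat) \<Rightarrow> nat \<Rightarrow> rep_family" where
  "assign S \<eta> \<phi> l = (if l \<in> S then gen (\<phi> l) else \<eta> l)"

text \<open>Commuting with \<open>gen i\<close> is a derivation. The Leibniz terms at the two ends
  of a summed chord cancel by \<open>chord_invariant\<close>, so only the letters outside
  \<open>S\<close> contribute. The induction moves one chord at a time from \<open>S\<close> into
  \<open>\<eta>\<close>.\<close>

lemma commutator_colsum:
  assumes "finite S" "\<forall>l\<in>S. count_list D l = 2" "i \<in> {1,2,3}"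
  defines "F \<equiv> \<lambda>S \<eta>. colsum S (\<lambda>\<phi>. prod_list (map (assign S \<eta> \<phi>) D))"
  shows "gen i * F S \<eta> - F S \<eta> * gen i
    = colsum S (\<lambda>\<phi>. dprod (assign S \<eta> \<phi>)
                        (\<lambda>l. if l \<in> S then 0 else gen i * \<eta> l - \<eta> l * gen i) D)"
  using assms(1,2)
proof (induction S arbitrary: \<eta> rule: finite_induct)
  case empty
  have "assign {} \<eta> \<phi> = \<eta>" for \<phi> by (simp add: assign_def fun_eq_iff)
  thus ?case unfolding F_def by (simp add: colsum_empty commutator_prod_list)
next
  case (insert l S)
  let ?ad = "\<lambda>a. gen i * a - a * gen i"
  have assign: "assign (insert l S) \<eta> (\<phi>(l := j)) = assign S (\<eta>(l := gen j)) \<phi>" for \<phi> j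
    using insert.hyps(2) by (auto simp: assign_def fun_eq_iff)
  have F: "F (insert l S) \<eta> = (\<Sum>j\<in>{1,2,3}. F S (\<eta>(l := gen j)))"
    unfolding F_def colsum_insert[OF insert.hyps(2)] assign ..
  obtain A B C where D: "D = A @ l # B @ l # C" "l \<notin> set A" "l \<notin> set B" "l \<notin> set C"
    using insert.prems count_list_2_split by (metis insertI1)
  \<comment> \<open>The terms that differentiate the two ends of \<open>l\<close> vanish once the
    colour of \<open>l\<close> is summed, whatever the other colours are.\<close>
  have zero: "(\<Sum>j\<in>{1,2,3}. colsum S (\<lambda>\<phi>. dprod (assign S (\<eta>(l := gen j)) \<phi>)
      (\<lambda>m. if m = l then ?ad (gen j) else 0) D)) = 0"
  proof -
    have "(\<Sum>j\<in>{1,2,3}. dprod (assign S (\<eta>(l := gen j)) \<phi>)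
        (\<lambda>m. if m = l then ?ad (gen j) else 0) D) = 0" for \<phi>
    proof -
      let ?p = "\<lambda>E. prod_list (map (assign S \<eta> \<phi>) E)"
      have p: "prod_list (map (assign S (\<eta>(l := gen j)) \<phi>) E) = ?p E" if "l \<notin> set E" for j E
        using that by (auto simp: assign_def intro!: arg_cong[of _ _ prod_list])
      have "dprod (assign S (\<eta>(l := gen j)) \<phi>) (\<lambda>m. if m = l then ?ad (gen j) else 0) D
          = ?p A * (?ad (gen j) * ?p B * gen j + gen j * ?p B * ?ad (gen j)) * ?p C" for j
        unfolding D(1) dprod_twice[OF D(2-)] p[OF D(2)] p[OF D(3)] p[OF D(4)]
        using insert.hyps(2) by (simp add: assign_def)
      hence "(\<Sum>j\<in>{1,2,3}. dprod (assign S (\<eta>(l := gen j)) \<phi>)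
            (\<lambda>m. if m = l then ?ad (gen j) else 0) D)
          = ?p A * (\<Sum>j\<in>{1,2,3}. ?ad (gen j) * ?p B * gen j + gen j * ?p B * ?ad (gen j)) * ?p C"
        by (simp only: sum_distrib_left sum_distrib_right)
      thus ?thesis using chord_invariant[OF assms(3)] by simp
    qed
    thus ?thesis unfolding colsum_sum by (simp add: colsum_def)
  qed
  have "gen i * F (insert l S) \<eta> - F (insert l S) \<eta> * gen i
      = (\<Sum>j\<in>{1,2,3}. ?ad (F S (\<eta>(l := gen j))))"
    unfolding F by (simp only: sum_distrib_left sum_distrib_right sum_subtractf)
  also have "\<dots> = (\<Sum>j\<in>{1,2,3}. colsum S (\<lambda>\<phi>. dprod (assign S (\<eta>(l := gen j)) \<phi>)
      (\<lambda>m. if m \<in> S then 0 else ?ad ((\<eta>(l := gen j)) m)) D))"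
    using insert.prems by (intro sum.cong refl insert.IH) auto
  \<comment> \<open>The induction hypothesis also differentiates \<open>l\<close>, which now counts
    as a fixed letter. That contribution is split off so that \<open>zero\<close> removes
    it.\<close>
  also have "\<dots> = (\<Sum>j\<in>{1,2,3}. colsum S (\<lambda>\<phi>. dprod (assign S (\<eta>(l := gen j)) \<phi>)
      (\<lambda>m. (if m \<in> insert l S then 0 else ?ad (\<eta> m)) + (if m = l then ?ad (gen j) else 0)) D))"
    using insert.hyps(2) by (intro sum.cong refl colsum_cong dprod_cong) auto
  also have "\<dots> = (\<Sum>j\<in>{1,2,3}. colsum S (\<lambda>\<phi>. dprod (assign S (\<eta>(l := gen j)) \<phi>)
      (\<lambda>m. if m \<in> insert l S then 0 else ?ad (\<eta> m)) D))"
    unfolding dprod_add colsum_add sum.distrib zero by (rule add_0_right)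
  also have "\<dots> = colsum (insert l S) (\<lambda>\<phi>. dprod (assign (insert l S) \<eta> \<phi>)
      (\<lambda>m. if m \<in> insert l S then 0 else ?ad (\<eta> m)) D)"
    unfolding colsum_insert[OF insert.hyps(2)] assign ..
  finally show ?case .
qed

text \<open>The argument \<open>P\<close> is inserted between the strands as a letter
  \<open>N\<close> that is not a chord. By \<open>commutator_colsum\<close> the only surviving
  Leibniz term is the one at \<open>N\<close>.\<close>

lemma transfer_op_equivariant:
  assumes "is_share I" "i \<in> {1,2,3}"
  shows "gen i * transfer_op I P - transfer_op I P * gen i = transfer_op I (gen i * P - P * gen i)"
proof -
  let ?S = "set (fst I) \<union> set (snd I)"
  obtain N where N: "N \<notin> ?S" using ex_new_if_finite[of ?S] by auto
  let ?D = "fst I @ N # snd I" and ?\<eta> = "\<lambda>_::nat. P"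
  have cnt: "\<forall>l\<in>?S. count_list ?D l = 2"
    using assms(1) N by (auto simp: is_share_def)
  have w: "prod_list (map (assign ?S ?\<eta> \<phi>) E) = word \<phi> E" if "set E \<subseteq> ?S" for \<phi> E
    using that by (auto simp: word_def assign_def intro!: arg_cong[of _ _ prod_list])
  have aN: "assign ?S ?\<eta> \<phi> N = P" for \<phi> using N by (simp add: assign_def)
  have "transfer_op I P = colsum ?S (\<lambda>\<phi>. prod_list (map (assign ?S ?\<eta> \<phi>) ?D))"
    unfolding transfer_op_def by (simp add: w aN mult.assoc)
  moreover have "transfer_op I (gen i * P - P * gen i) = colsum ?S (\<lambda>\<phi>. dprod (assign ?S ?\<eta> \<phi>)
                        (\<lambda>l. if l \<in> ?S then 0 else gen i * P - P * gen i) ?D)"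
  proof -
    have "dprod (assign ?S ?\<eta> \<phi>) (\<lambda>l. if l \<in> ?S then 0 else gen i * P - P * gen i) ?D
      = word \<phi> (fst I) * (gen i * P - P * gen i) * word \<phi> (snd I)" for \<phi>
    proof -
      have z: "dprod (assign ?S ?\<eta> \<phi>) (\<lambda>l. if l \<in> ?S then 0 else gen i * P - P * gen i) E = 0"
        if "set E \<subseteq> ?S" for E using that by (intro dprod_zero) auto
      show ?thesis
        using N unfolding dprod_append dprod.simps
        by (simp only: w[OF Un_upper1] w[OF Un_upper2] z[OF Un_upper1] z[OF Un_upper2]) (simp add: mult.assoc)
    qed
    thus ?thesis unfolding transfer_op_def by simp
  qed
  ultimately show ?thesis
    using commutator_colsum[OF _ cnt assms(2), of ?\<eta>] by simp
qed

section \<open>Existence of the weight polynomial\<close>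

definition diagram_sum :: "chord_diagram \<Rightarrow> rep_family" where
  "diagram_sum D = colsum (set D) (\<lambda>\<phi>. word \<phi> D)"

lemma rep_sum: "Rep_rep_family (sum f S) k r s = (\<Sum>x\<in>S. Rep_rep_family (f x) k r s)"
  by (induction S rule: infinite_finite_induct)
     (simp_all add: zero_rep_family.rep_eq plus_rep_family.rep_eq)

lemma rep_word: "Rep_rep_family (word \<phi> D) k = foldr (\<lambda>l M. mmul k (rho k (\<phi> l)) M) D (idm k)"
  by (induction D) (simp_all add: one_rep_family.rep_eq times_rep_family.rep_eq gen.rep_eq)

lemma wk_eq: "wk k D = Rep_rep_family (diagram_sum D) k"
  unfolding wk_def diagram_sum_def colsum_def by (simp add: fun_eq_iff rep_sum rep_word)

text \<open>A diagram is a share with empty second strand, and its map is left multiplication by the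
  diagram sum. Equivariance at \<open>1\<close>, whose commutators vanish, gives centrality.\<close>

lemma diagram_sum_central:
  assumes "\<forall>l\<in>set D. count_list D l = 2" "i \<in> {1,2,3}"
  shows "gen i * diagram_sum D = diagram_sum D * gen i"
proof -
  have "transfer_op (D, []) P = diagram_sum D * P" if "P = 1 \<or> P = 0" for P
    using that unfolding transfer_op_def diagram_sum_def by (auto simp: colsum_def)
  from this[of 1] this[of 0] show ?thesis
    using transfer_op_equivariant[of "(D, [])" i 1] assms by (simp add: is_share_def)
qed

section \<open>Central elements act on each module by a scalar\<close>

lemma mmul_gen_column:
  assumes "s \<le> k"
  shows "mmul k A (fm k) r s = (if s < k then A r (s + 1) else 0)"
    and "mmul k A (hm k) r s = (of_nat k - 2 * of_nat s) * A r s"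
proof -
  have "mmul k A (fm k) r s = (\<Sum>l\<le>k. if l = s + 1 then A r (s + 1) else 0)"
    unfolding mmul_def fm_def by (intro sum.cong) auto
  thus "mmul k A (fm k) r s = (if s < k then A r (s + 1) else 0)" by auto
  have "mmul k A (hm k) r s = (\<Sum>l\<le>k. if l = s then (of_nat k - 2 * of_nat s) * A r s else 0)"
    unfolding mmul_def hm_def using assms by (intro sum.cong) auto
  thus "mmul k A (hm k) r s = (of_nat k - 2 * of_nat s) * A r s" using assms by auto
qed

text \<open>Schur's lemma by hand: commuting with \<open>weight\<close> forces a diagonal matrix
  because the weights \<open>k - 2 * r\<close> are distinct, and commuting with \<open>lower\<close>
  makes neighbouring diagonal entries equal.\<close>

lemma central_imp_scalar:
  assumes "\<And>i. i \<in> {1,2,3} \<Longrightarrow> gen i * a = a * gen i"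
  shows "Rep_rep_family a k r s = Rep_rep_family a k 0 0 * idm k r s"
proof -
  have w: "weight = gen 3 + gen 3" unfolding gen_eq by (rule half_add[symmetric])
  have weight: "weight * a = a * weight"
    unfolding w distrib_left distrib_right using assms[of 3] by simp
  have "gen 1 - imu * gen 2 = half * lower + half * lower"
    unfolding gen_eq by (simp add: scal_comms imu_imu algebra_simps)
  hence l: "lower = gen 1 - imu * gen 2" by (simp only: half_add)
  have "imu * gen 2 * a = a * (imu * gen 2)"
    using assms[of 2] by (simp add: scal_left_commute mult.assoc)
  hence lower: "lower * a = a * lower"
    unfolding l left_diff_distrib right_diff_distrib using assms[of 1] by simp
  have diag: "Rep_rep_family a k r s = 0" if "r \<le> k" "s \<le> k" "r \<noteq> s" for r s
  proof -
    have "Rep_rep_family (weight * a) k r s = Rep_rep_family (a * weight) k r s"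
      using weight by simp
    thus ?thesis using that
      by (simp add: times_rep_family.rep_eq weight.rep_eq mmul_gen_row mmul_gen_column)
  qed
  have const: "Rep_rep_family a k s s = Rep_rep_family a k 0 0" if "s \<le> k" for s
    using that
  proof (induction s)
    case (Suc s)
    have "Rep_rep_family (lower * a) k (Suc s) s = Rep_rep_family (a * lower) k (Suc s) s"
      using lower by simp
    thus ?case using Suc
      by (simp add: times_rep_family.rep_eq lower.rep_eq mmul_gen_row mmul_gen_column)
  qed simp
  show ?thesis
    using diag[of r s] const[of s] Rep_rep_family[of a] by (cases "r \<le> k \<and> s \<le> k") (auto simp: idm_def)
qed

text \<open>The Verma module of highest weight \<open>z\<close>, in coordinates: for \<open>z = k\<close> its coordinates
  \<open>0, \<dots>, k\<close> are acted on exactly as in \<open>V\<^sub>k\<close>, and the coordinates beyond \<open>k\<close> form a copy of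
  the module of highest weight \<open>- k - 2\<close>. The resulting symmetry under \<open>k \<mapsto> - k - 2\<close> is what makes
  the scalar by which a central element acts a polynomial in \<open>k (k + 2)\<close>.\<close>

definition verma :: "complex \<Rightarrow> nat \<Rightarrow> (nat \<Rightarrow> complex) \<Rightarrow> nat \<Rightarrow> complex" where
  "verma z i v r =
    (let E = of_nat (r + 1) * (z - of_nat r) * v (r + 1); F = (if r = 0 then 0 else v (r - 1))
     in if i = 1 then (E + F) / 2 else if i = 2 then \<i> * (F - E) / 2 else (z - 2 * of_nat r) * v r / 2)"

definition verma_word :: "complex \<Rightarrow> (nat \<Rightarrow> nat) \<Rightarrow> nat list \<Rightarrow> nat \<Rightarrow> nat \<Rightarrow> complex" where
  "verma_word z \<phi> D s = foldr (\<lambda>l. verma z (\<phi> l)) D (\<lambda>r. if r = s then 1 else 0)"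

lemma mmul_rho_row:
  assumes "r \<le> k"
  shows "mmul k (rho k i) A r s = verma (of_nat k) i (\<lambda>l. A l s) r"
proof -
  have "mmul k (\<lambda>r s. (B r s + C r s) / 2) A r s = (mmul k B A r s + mmul k C A r s) / 2"
    "mmul k (\<lambda>r s. \<i> * (C r s - B r s) / 2) A r s = \<i> * (mmul k C A r s - mmul k B A r s) / 2"
    "mmul k (\<lambda>r s. B r s / 2) A r s = mmul k B A r s / 2" for B C
    by (simp_all add: mmul_def sum_distrib_left sum_divide_distrib sum.distrib sum_subtractf
      algebra_simps add_divide_distrib diff_divide_distrib)
  thus ?thesis using mmul_gen_row[OF assms] by (simp add: rho_def verma_def Let_def)
qed

text \<open>For \<open>z = k\<close> and \<open>r = k\<close> the coefficient \<open>z - r\<close>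
  of the next coordinate vanishes, so coordinates beyond \<open>k\<close> never influence those up
  to \<open>k\<close>.\<close>

lemma verma_cong:
  assumes "r \<le> k" "\<And>l. l \<le> k \<Longrightarrow> v l = v' l"
  shows "verma (of_nat k) i v r = verma (of_nat k) i v' r"
  using assms by (cases "r = k") (auto simp: verma_def Let_def)

lemma rep_word_verma:
  "r \<le> k \<Longrightarrow> s \<le> k \<Longrightarrow> Rep_rep_family (word \<phi> D) k r s = verma_word (of_nat k) \<phi> D s r"
proof (induction D arbitrary: r)
  case Nil
  thus ?case by (simp add: one_rep_family.rep_eq idm_def verma_word_def)
next
  case (Cons l D)
  have "Rep_rep_family (word \<phi> (l # D)) k r s
      = verma (of_nat k) (\<phi> l) (\<lambda>l. Rep_rep_family (word \<phi> D) k l s) r"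
    using Cons.prems by (simp add: times_rep_family.rep_eq gen.rep_eq mmul_rho_row)
  also have "\<dots> = verma (of_nat k) (\<phi> l) (verma_word (of_nat k) \<phi> D s) r"
    using Cons by (intro verma_cong) auto
  finally show ?case by (simp add: verma_word_def)
qed

lemma verma_word_poly: "\<exists>p. \<forall>z. verma_word z \<phi> D s r = poly p z"
proof (induction D arbitrary: r)
  case Nil
  show ?case by (rule exI[of _ "[:if r = s then 1 else 0:]"]) (simp add: verma_word_def)
next
  case (Cons l D)
  then obtain p where p: "\<And>r z. verma_word z \<phi> D s r = poly (p r) z" by metis
  define E where "E = smult (of_nat (r + 1)) ([:- of_nat r, 1:] * p (r + 1))"
  define F where "F = (if r = 0 then 0 else p (r - 1))"
  define q where "q = (if \<phi> l = 1 then smult (1/2) (E + F)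
    else if \<phi> l = 2 then smult (\<i>/2) (F - E) else smult (1/2) ([:- 2 * of_nat r, 1:] * p r))"
  have "verma_word z \<phi> (l # D) s r = verma z (\<phi> l) (verma_word z \<phi> D s) r" for z
    by (simp add: verma_word_def)
  also have "verma z (\<phi> l) (verma_word z \<phi> D s) r = poly q z" for z
    by (simp add: verma_def Let_def p q_def E_def F_def field_simps)
  finally show ?case by blast
qed

text \<open>For \<open>r = t + k + 1\<close>, the raising coefficient
  \<open>(r + 1) * (k - r)\<close> equals \<open>(t + 1) * ((- k - 2) - t)\<close> and the weight
  \<open>k - 2 * r\<close> equals \<open>(- k - 2) - 2 * t\<close>. At \<open>r = k\<close> the
  raising coefficient is zero, so nothing leaves the submodule.\<close>

lemma verma_shift:
  fixes k :: nat
  defines "shift \<equiv> \<lambda>v r. if r < Suc k then 0 else v (r - Suc k)"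
  shows "verma (of_nat k) i (shift v) = shift (verma (- of_nat k - 2) i v)"
proof
  fix r
  consider "r < k" | "r = k" | "r = Suc k" | t where "r = Suc (Suc k) + t"
    by (metis add_Suc_right le_Suc_ex less_Suc_eq_le not_less_less_Suc_eq nat_le_linear le_neq_implies_less Suc_leI)
  thus "verma (of_nat k) i (shift v) r = shift (verma (- of_nat k - 2) i v) r"
    by cases (auto simp: verma_def Let_def shift_def algebra_simps)
qed

lemma verma_word_shift:
  "verma_word (of_nat k) \<phi> D (Suc k) (Suc k) = verma_word (- of_nat k - 2) \<phi> D 0 0"
proof -
  define shift where "shift = (\<lambda>v r. if r < Suc k then 0 else v (r - Suc k) :: complex)"
  have "foldr (\<lambda>l. verma (of_nat k) (\<phi> l)) D (shift v)
      = shift (foldr (\<lambda>l. verma (- of_nat k - 2) (\<phi> l)) D v)" for v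
    by (induction D) (simp_all add: shift_def verma_shift)
  moreover have "(\<lambda>r. if r = Suc k then 1 else 0) = shift (\<lambda>r. if r = 0 then 1 else 0)"
    by (auto simp: shift_def fun_eq_iff)
  ultimately show ?thesis unfolding verma_word_def by (simp only:) (simp add: shift_def)
qed

text \<open>Division with remainder by \<open>z * (z + 2) / 4\<close>, which is itself symmetric and
  vanishes at \<open>0\<close> and \<open>-2\<close>. The linear remainder takes equal values at
  these two points and is constant; the quotient is again symmetric and has smaller degree.\<close>

lemma symmetric_poly:
  fixes p :: "complex poly"
  assumes "pcompose p [:-2, -1:] = p"
  shows "\<exists>q. \<forall>z. poly p z = poly q (z * (z + 2) / 4)"
  using assms
proof (induction "degree p" arbitrary: p rule: less_induct)
  case less
  define f :: "complex poly" where "f = [:0, 1/2, 1/4:]"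
  define d where "d = p div f"
  define r where "r = p mod f"
  have f: "degree f = 2" "f \<noteq> 0" by (auto simp: f_def)
  have dr: "degree r < 2" using degree_mod_less[of f p] f by (auto simp: r_def)
  have p: "p = d * f + r" by (simp add: d_def r_def)
  have f_sym: "pcompose f [:-2, -1:] = f" by (simp add: f_def pcompose_pCons)
  obtain a b where r: "r = [:a, b:]"
  proof
    show "r = [:coeff r 0, coeff r 1:]"
      using dr by (intro poly_eqI) (auto simp: coeff_pCons coeff_eq_0 split: nat.split)
  qed
  have "poly p (-2) = poly p 0"
    using arg_cong[OF less.prems, of "\<lambda>p. poly p 0"] by (simp add: poly_pcompose)
  hence b: "b = 0" unfolding p by (simp add: f_def r)
  have "pcompose d [:-2, -1:] * f + [:a:] = d * f + [:a:]"
    using less.prems unfolding p by (simp add: pcompose_add pcompose_mult f_sym r b)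
  hence sym: "pcompose d [:-2, -1:] = d" using f by simp
  show ?case
  proof (cases "d = 0")
    case True
    thus ?thesis unfolding p r b by (auto intro!: exI[of _ "[:a:]"])
  next
    case False
    hence "degree (d * f) = degree d + 2" using f by (simp add: degree_mult_eq)
    hence "degree d < degree p" unfolding p using dr by (subst degree_add_eq_left) auto
    from less.hyps[OF this sym] obtain q where q: "\<And>z. poly d z = poly q (z * (z + 2) / 4)" by blast
    have "poly p z = poly (pCons a q) (z * (z + 2) / 4)" for z
      unfolding p by (simp add: r b q f_def field_simps)
    thus ?thesis by blast
  qed
qed

text \<open>Each diagonal entry \<open>s\<close> is a polynomial \<open>p s\<close> in
  \<open>k\<close>, computed in the Verma module. Centrality makes all \<open>p s\<close> equal, and
  the submodule starting at coordinate \<open>k + 1\<close> supplies the symmetry that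
  \<open>symmetric_poly\<close> requires.\<close>

lemma diagram_sum_scalar:
  assumes D: "\<forall>l\<in>set D. count_list D l = 2"
  shows "\<exists>q. diagram_sum D = scal q"
proof -
  have scalar: "Rep_rep_family (diagram_sum D) k r s = Rep_rep_family (diagram_sum D) k 0 0 * idm k r s"
    for k r s by (intro central_imp_scalar diagram_sum_central D)
  have ex: "\<exists>p. \<forall>z. colsum (set D) (\<lambda>\<phi>. verma_word z \<phi> D s s) = poly p z" for s
  proof -
    have "\<exists>p. \<forall>\<phi> z. verma_word z \<phi> D s s = poly (p \<phi>) z"
      by (intro choice allI verma_word_poly)
    then obtain p where "\<forall>\<phi> z. verma_word z \<phi> D s s = poly (p \<phi>) z" ..
    thus ?thesis unfolding colsum_def
      by (intro exI[of _ "\<Sum>\<phi>\<in>PiE (set D) (\<lambda>_. {1,2,3}). p \<phi>"]) (simp add: poly_sum)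
  qed
  have "\<exists>p. \<forall>s z. colsum (set D) (\<lambda>\<phi>. verma_word z \<phi> D s s) = poly (p s) z"
    by (intro choice allI ex)
  then obtain p where p: "\<And>s z. colsum (set D) (\<lambda>\<phi>. verma_word z \<phi> D s s) = poly (p s) z" by blast
  have rep: "Rep_rep_family (diagram_sum D) k s s = poly (p s) (of_nat k)" if "s \<le> k" for k s
    unfolding p[symmetric] diagram_sum_def colsum_def rep_sum
    using that by (intro sum.cong rep_word_verma refl) auto
  have eq: "p s = p 0" for s
  proof (rule poly_eqI_infinite)
    show "infinite (of_nat ` {s..} :: complex set)"
      by (subst finite_image_iff) (auto simp: inj_on_def infinite_Ici)
    show "poly (p s) x = poly (p 0) x" if "x \<in> of_nat ` {s..}" for x
      using that rep[of s] rep[of 0] scalar[of _ s s] by (auto simp: idm_def)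
  qed
  have "pcompose (p 0) [:-2, -1:] = p 0"
  proof (rule poly_eqI_infinite)
    show "infinite (range of_nat :: complex set)"
      by (rule range_inj_infinite) (rule inj_of_nat)
    fix x :: complex assume "x \<in> range of_nat"
    then obtain k where x: "x = of_nat k" by auto
    \<comment> \<open>Coordinate \<open>k + 1\<close> lies outside the module, so \<open>rep\<close>
      says nothing here. The equality holds because \<open>p (Suc k)\<close> and \<open>p 0\<close>
      agree as polynomials.\<close>
    have "poly (p 0) x = poly (p (Suc k)) x" using eq[of "Suc k"] by simp
    also have "\<dots> = poly (p 0) (- of_nat k - 2)"
      unfolding x p[symmetric] verma_word_shift ..
    finally show "poly (pcompose (p 0) [:-2, -1:]) x = poly (p 0) x"
      by (simp add: poly_pcompose x algebra_simps)
  qed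
  then obtain q where "\<And>z. poly (p 0) z = poly q (z * (z + 2) / 4)" using symmetric_poly by blast
  hence "Rep_rep_family (diagram_sum D) k 0 0 = poly q (cas k)" for k
    using rep[of 0 k] by (simp add: cas_def)
  hence "diagram_sum D = scal q"
    by (intro rep_family_eqI) (subst scalar, simp add: scal.rep_eq)
  thus ?thesis ..
qed

text \<open>Existence of the polynomial comes from \<open>diagram_sum_scalar\<close>, uniqueness
  from injectivity of \<open>scal\<close>. Hence the definite description in \<open>w_sl2\<close>
  denotes.\<close>

lemma scal_w_sl2:
  assumes D: "\<forall>l\<in>set D. count_list D l = 2"
  shows "scal (w_sl2 D) = diagram_sum D"
proof -
  obtain q where q: "diagram_sum D = scal q" using diagram_sum_scalar[OF D] by blast
  have "(\<forall>k. wk k D = (\<lambda>r s. poly p (cas k) * idm k r s)) \<longleftrightarrow> p = q" for p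
  proof -
    have "(\<forall>k. wk k D = (\<lambda>r s. poly p (cas k) * idm k r s))
      \<longleftrightarrow> Rep_rep_family (diagram_sum D) = Rep_rep_family (scal p)"
      by (simp add: wk_eq fun_eq_iff scal.rep_eq)
    thus ?thesis using q by (auto simp: Rep_rep_family_inject scal_inject)
  qed
  thus ?thesis unfolding w_sl2_def q by simp
qed

section \<open>Operators on invariant maps\<close>

lemma sum_colours: "(\<Sum>j\<in>{1,2,3::nat}. f j) = f 1 + f 2 + (f 3 :: rep_family)"
  by (simp add: add.assoc)

definition bridge :: "rep_family \<Rightarrow> rep_family" where
  "bridge M = (\<Sum>j\<in>{1,2,3}. gen j * M * gen j)"

definition opU_map :: "(rep_family \<Rightarrow> rep_family) \<Rightarrow> rep_family \<Rightarrow> rep_family" where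
  "opU_map T M = (\<Sum>j\<in>{1,2,3}. gen j * T (gen j * M))"

definition opX_map :: "(rep_family \<Rightarrow> rep_family) \<Rightarrow> rep_family \<Rightarrow> rep_family" where
  "opX_map T M = (\<Sum>j\<in>{1,2,3}. T (gen j * M) * gen j)"

text \<open>The operator identities below are stated for such maps rather than for shares because
  they are applied to polynomials in \<open>bridge\<close>.\<close>

definition invariant_map :: "(rep_family \<Rightarrow> rep_family) \<Rightarrow> bool" where
  "invariant_map T \<longleftrightarrow> (\<forall>a b. T (a + b) = T a + T b) \<and> (\<forall>p a. T (scal p * a) = scal p * T a) \<and>
     (\<forall>i\<in>{1,2,3}. \<forall>a. gen i * T a - T a * gen i = T (gen i * a - a * gen i))"

lemma invariant_mapI:
  assumes "\<And>a b. T (a + b) = T a + T b" "\<And>p a. T (scal p * a) = scal p * T a"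
    and "\<And>i a. i \<in> {1,2,3} \<Longrightarrow> gen i * T a - T a * gen i = T (gen i * a - a * gen i)"
  shows "invariant_map T"
  using assms unfolding invariant_map_def by blast

context
  fixes T assumes T: "invariant_map T"
begin

lemma invariant_map_add: "T (a + b) = T a + T b"
  using T unfolding invariant_map_def by blast

lemma invariant_map_scal: "T (scal p * a) = scal p * T a"
  using T unfolding invariant_map_def by blast

lemma invariant_map_commutator:
  "i \<in> {1,2,3} \<Longrightarrow> gen i * T a - T a * gen i = T (gen i * a - a * gen i)"
  using T unfolding invariant_map_def by blast

lemma invariant_map_zero: "T 0 = 0"
  using invariant_map_scal[of 0 0] by simp

lemma invariant_map_diff: "T (a - b) = T a - T b"
  using invariant_map_add[of "a - b" b] by simp

lemma invariant_map_sum: "T (sum f S) = (\<Sum>x\<in>S. T (f x))"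
  by (induction S rule: infinite_finite_induct) (simp_all add: invariant_map_add invariant_map_zero)

end

lemma casimir_sum: "(\<Sum>j\<in>{1,2,3}. gen j * (gen j * M)) = casimir * M"
  unfolding sum_colours casimir_eq[symmetric] by (simp add: distrib_right mult.assoc)

text \<open>This is \<open>U = c + X - Y\<close>. Moving the outer \<open>gen j\<close> from left to
  right costs a commutator with a value of \<open>T\<close>; equivariance carries it inside, where
  it yields \<open>c\<close> and \<open>bridge\<close>.\<close>

lemma opU_map_eq:
  assumes T: "invariant_map T"
  shows "opU_map T M = casimir * T M + opX_map T M - T (bridge M)"
proof -
  have "opU_map T M - opX_map T M
      = (\<Sum>j\<in>{1,2,3}. gen j * T (gen j * M) - T (gen j * M) * gen j)"
    unfolding opU_map_def opX_map_def by (rule sum_subtractf[symmetric])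
  also have "\<dots> = (\<Sum>j\<in>{1,2,3}. T (gen j * (gen j * M)) - T (gen j * M * gen j))"
    by (intro sum.cong refl) (simp only: invariant_map_commutator[OF T] invariant_map_diff[OF T])
  also have "\<dots> = T (casimir * M) - T (bridge M)"
    unfolding sum_subtractf invariant_map_sum[OF T, symmetric] casimir_sum bridge_def ..
  finally show ?thesis by (simp add: invariant_map_scal[OF T] algebra_simps)
qed

text \<open>Joining the two strands at their beginnings gives the same operator as joining them at their
  ends: in the language of four spins with total spin zero, \<open>a \<cdot> c = b \<cdot> d\<close>.\<close>

lemma opX_map_eq:
  assumes T: "invariant_map T"
  shows "(\<Sum>j\<in>{1,2,3}. gen j * T (M * gen j)) = opX_map T M" (is "?A = _")
proof -
  let ?S = "\<lambda>f. \<Sum>j\<in>{1,2,3::nat}. f j"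
  have c_right: "?S (\<lambda>j. a * gen j * gen j) = casimir * a" for a
  proof -
    have "?S (\<lambda>j. a * gen j * gen j) = a * (gen 1 * gen 1 + gen 2 * gen 2 + gen 3 * gen 3)"
      by (simp only: sum_colours distrib_left mult.assoc)
    thus ?thesis unfolding casimir_eq scal_commute .
  qed
  have comm: "gen j * T a - T a * gen j = T (gen j * a) - T (a * gen j)" if "j \<in> {1,2,3}" for j a
    using invariant_map_commutator[OF T that] invariant_map_diff[OF T] by simp
  let ?AD = "?S (\<lambda>j. gen j * T M * gen j)" and ?CD = "?S (\<lambda>j. T (M * gen j) * gen j)"
  have 1: "casimir * T M - ?AD = opU_map T M - ?A"
  proof -
    have "casimir * T M - ?AD = ?S (\<lambda>j. gen j * (gen j * T M - T M * gen j))"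
      unfolding right_diff_distrib sum_subtractf casimir_sum mult.assoc ..
    also have "\<dots> = ?S (\<lambda>j. gen j * (T (gen j * M) - T (M * gen j)))"
      by (intro sum.cong refl) (simp only: comm)
    finally show ?thesis unfolding opU_map_def right_diff_distrib sum_subtractf .
  qed
  have 2: "?A - ?CD = T (bridge M) - casimir * T M"
  proof -
    have "?A - ?CD = ?S (\<lambda>j. T (gen j * (M * gen j)) - T (M * gen j * gen j))"
      unfolding sum_subtractf[symmetric] by (intro sum.cong refl) (simp only: comm)
    also have "\<dots> = T (bridge M) - T (casimir * M)"
      unfolding sum_subtractf invariant_map_sum[OF T, symmetric] mult.assoc[symmetric] c_right bridge_def ..
    finally show ?thesis by (simp only: invariant_map_scal[OF T])
  qed
  have 3: "?AD - casimir * T M = opX_map T M - ?CD"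
  proof -
    have "?AD - casimir * T M = ?S (\<lambda>j. (gen j * T M - T M * gen j) * gen j)"
      unfolding left_diff_distrib sum_subtractf c_right ..
    also have "\<dots> = ?S (\<lambda>j. (T (gen j * M) - T (M * gen j)) * gen j)"
      by (intro sum.cong refl) (simp only: comm)
    finally show ?thesis unfolding opX_map_def left_diff_distrib sum_subtractf .
  qed
  have 4: "opU_map T M = casimir * T M + opX_map T M - T (bridge M)" by (rule opU_map_eq[OF T])
  \<comment> \<open>Adding \<open>1\<close> and \<open>3\<close> cancels \<open>?AD\<close> and
    \<open>casimir * T M\<close>. Then \<open>2\<close> removes \<open>?CD\<close> and
    \<open>4\<close> removes \<open>opU_map T M\<close>, which leaves twice the claim.\<close>
  have "(opU_map T M - ?A) + (opX_map T M - ?CD) = 0"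
    unfolding 1[symmetric] 3[symmetric] by simp
  moreover have "a + a = b + d + (a - f) - ((b - a) + (d - f))" for a b d f :: rep_family by simp
  ultimately have "?A + ?A = opU_map T M + opX_map T M + (?A - ?CD) - 0" by metis
  also have "\<dots> = opX_map T M + opX_map T M" unfolding 2 4 by simp
  finally have "?A + ?A = opX_map T M + opX_map T M" .
  hence "half * (?A + ?A) = half * (opX_map T M + opX_map T M)" by simp
  thus ?thesis unfolding distrib_left half_add .
qed

text \<open>The classical identity for the double commutator of the square of the angular momentum with
  a vector operator: \<open>bridge\<close> is \<open>c\<close> minus half the Casimir operator of the adjoint action.\<close>

lemma double_commutator_cyclic:
  fixes a b d M :: rep_family
  assumes ab: "a * b - b * a = imu * d" and bd: "b * d - d * b = imu * a" and da: "d * a - a * d = imu * b"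
    and cas: "a * a + b * b + d * d = casimir" and y: "\<And>M. y M = a * M * a + b * M * b + d * M * d"
  shows "a * y (y M) - (y (a * y M) + y (a * y M)) + y (y (a * M))
    = casimir * (a * M) - y (a * M) + casimir * (M * a) - y M * a"
proof -
  have step: "y (a * M) - a * y M = imu * (b * M * d - d * M * b)" for M
  proof -
    have "y (a * M) - a * y M = (d * a - a * d) * M * d - (a * b - b * a) * M * b"
      unfolding y by (simp add: algebra_simps)
    thus ?thesis unfolding ab da by (simp add: algebra_simps)
  qed
  have bMd: "y (b * M * d) - b * y M * d
      = imu * (d * M * d * a + b * a * M * b - b * b * M * a - a * M * d * d)" for M
  proof -
    have "y (b * M * d) - b * y M * d
      = (a * b - b * a) * M * d * a + b * a * M * (d * a - a * d)
        - b * b * M * (b * d - d * b) - (b * d - d * b) * M * d * d"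
      unfolding y by (simp add: algebra_simps)
    thus ?thesis unfolding ab bd da by (simp add: algebra_simps scal_left_commute)
  qed
  have dMb: "y (d * M * b) - d * y M * b
      = - imu * (b * M * b * a + d * a * M * d - d * d * M * a - a * M * b * b)" for M
  proof -
    have "y (d * M * b) - d * y M * b
      = - (d * a - a * d) * M * b * a - d * a * M * (a * b - b * a)
        + d * d * M * (b * d - d * b) + (b * d - d * b) * M * b * b"
      unfolding y by (simp add: algebra_simps)
    thus ?thesis unfolding ab bd da by (simp add: algebra_simps scal_left_commute)
  qed
  have lin: "y (imu * N) = imu * y N" "y (N - N') = y N - y N'" for N N'
    unfolding y by (simp_all add: algebra_simps scal_left_commute)
  \<comment> \<open>The double commutator is grouped as \<open>y\<close> after the simple commutator
    minus the simple commutator after \<open>y\<close>, so that \<open>step\<close> applies to both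
    parts and \<open>bMd\<close> and \<open>dMb\<close> evaluate the outer one.\<close>
  have "a * y (y M) - (y (a * y M) + y (a * y M)) + y (y (a * M))
      = y (y (a * M) - a * y M) - (y (a * y M) - a * y (y M))"
    by (simp add: lin)
  also have "\<dots> = imu * ((y (b * M * d) - b * y M * d) - (y (d * M * b) - d * y M * b))"
    unfolding step by (simp add: lin algebra_simps)
  also have "\<dots> = imu * (imu * ((d * M * d * a + b * a * M * b - b * b * M * a - a * M * d * d)
      + (b * M * b * a + d * a * M * d - d * d * M * a - a * M * b * b)))"
    unfolding bMd dMb by (simp add: algebra_simps)
  also have "\<dots> = a * M * casimir + casimir * (M * a) - y (a * M) - y M * a"
    unfolding imu_imu cas[symmetric] y by (simp add: algebra_simps)
  also have "a * M * casimir = casimir * (a * M)" by (rule scal_commute)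
  finally show ?thesis by simp
qed

lemma casimir_cyclic:
  "gen 2 * gen 2 + gen 3 * gen 3 + gen 1 * gen 1 = casimir"
  "gen 3 * gen 3 + gen 1 * gen 1 + gen 2 * gen 2 = casimir"
  using casimir_eq by (simp_all add: algebra_simps)

lemma double_commutator:
  assumes "i \<in> {1,2,3}"
  shows "gen i * bridge (bridge M) - (bridge (gen i * bridge M) + bridge (gen i * bridge M))
      + bridge (bridge (gen i * M))
    = casimir * (gen i * M) - bridge (gen i * M) + casimir * (M * gen i) - bridge M * gen i"
proof -
  have b: "bridge M = gen 1 * M * gen 1 + gen 2 * M * gen 2 + gen 3 * M * gen 3"
    "bridge M = gen 2 * M * gen 2 + gen 3 * M * gen 3 + gen 1 * M * gen 1"
    "bridge M = gen 3 * M * gen 3 + gen 1 * M * gen 1 + gen 2 * M * gen 2" for M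
    unfolding bridge_def sum_colours by (simp_all add: algebra_simps)
  consider "i = 1" | "i = 2" | "i = 3" using assms by auto
  thus ?thesis
  proof cases
    case 1 thus ?thesis using double_commutator_cyclic[OF imu_gen3 imu_gen1 imu_gen2 casimir_eq b(1)] by blast
  next
    case 2 thus ?thesis using double_commutator_cyclic[OF imu_gen1 imu_gen2 imu_gen3 casimir_cyclic(1) b(2)] by blast
  next
    case 3 thus ?thesis using double_commutator_cyclic[OF imu_gen2 imu_gen3 imu_gen1 casimir_cyclic(2) b(3)] by blast
  qed
qed

text \<open>The relation for \<open>Y^2 U - 2 Y U Y + U Y^2\<close>. Apply \<open>T\<close> to
  \<open>double_commutator\<close>, multiply by \<open>gen i\<close> from the left and sum over
  \<open>i\<close>. Right multiplications inside \<open>T\<close> become \<open>X\<close> by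
  \<open>opX_map_eq\<close>, and \<open>opU_map_eq\<close> eliminates \<open>X\<close>.\<close>

lemma racah_relation:
  assumes T: "invariant_map T"
  shows "opU_map T (bridge (bridge M))
      - (opU_map (\<lambda>a. T (bridge a)) (bridge M) + opU_map (\<lambda>a. T (bridge a)) (bridge M))
      + opU_map (\<lambda>a. T (bridge (bridge a))) M
    = casimir * (opU_map T M + opU_map T M + T (bridge M) + T (bridge M) - casimir * T M)
      - opU_map (\<lambda>a. T (bridge a)) M - opU_map T (bridge M) - T (bridge (bridge M))"
proof -
  let ?S = "\<lambda>f. \<Sum>j\<in>{1,2,3::nat}. f j"
  have "?S (\<lambda>i. gen i * T (gen i * bridge (bridge M)
        - (bridge (gen i * bridge M) + bridge (gen i * bridge M)) + bridge (bridge (gen i * M))))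
    = ?S (\<lambda>i. gen i * T (casimir * (gen i * M) - bridge (gen i * M) + casimir * (M * gen i) - bridge M * gen i))"
    by (intro sum.cong refl) (simp only: double_commutator)
  hence "opU_map T (bridge (bridge M))
      - (opU_map (\<lambda>a. T (bridge a)) (bridge M) + opU_map (\<lambda>a. T (bridge a)) (bridge M))
      + opU_map (\<lambda>a. T (bridge (bridge a))) M
    = casimir * opU_map T M - opU_map (\<lambda>a. T (bridge a)) M + casimir * ?S (\<lambda>i. gen i * T (M * gen i))
      - ?S (\<lambda>i. gen i * T (bridge M * gen i))"
    unfolding opU_map_def invariant_map_add[OF T] invariant_map_diff[OF T] invariant_map_scal[OF T]
      distrib_left right_diff_distrib scal_left_commute sum.distrib sum_subtractf sum_distrib_left[symmetric] .
  also have "\<dots> = casimir * opU_map T M - opU_map (\<lambda>a. T (bridge a)) M + casimir * opX_map T M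
      - opX_map T (bridge M)"
    unfolding opX_map_eq[OF T] ..
  also have "\<dots> = casimir * (opU_map T M + opU_map T M + T (bridge M) + T (bridge M) - casimir * T M)
      - opU_map (\<lambda>a. T (bridge a)) M - opU_map T (bridge M) - T (bridge (bridge M))"
    using opU_map_eq[OF T, of M] opU_map_eq[OF T, of "bridge M"] by (simp add: algebra_simps)
  finally show ?thesis .
qed

lemma sandwich_cyclic:
  fixes a b d :: rep_family
  assumes ab: "a * b - b * a = imu * d" and bd: "b * d - d * b = imu * a" and da: "d * a - a * d = imu * b"
    and cas: "a * a + b * b + d * d = casimir"
  shows "a * a * a + b * a * b + d * a * d = casimir * a - a"
proof -
  have "a * a * a + b * a * b + d * a * d
      = (a * a + b * b + d * d) * a + b * (a * b - b * a) - d * (d * a - a * d)"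
    by (simp add: algebra_simps)
  also have "\<dots> = casimir * a + imu * (b * d - d * b)"
    unfolding ab da cas by (simp add: algebra_simps scal_left_commute)
  also have "\<dots> = casimir * a - a" unfolding bd imu_imu by simp
  finally show ?thesis .
qed

text \<open>The starting value \<open>U y = (c - 1) y\<close>. Exchanging the sums encloses each
  \<open>gen j\<close> between two copies of \<open>gen i\<close>, and
  \<open>sandwich_cyclic\<close> evaluates that sum.\<close>

lemma opU_map_bridge: "opU_map bridge M = casimir * bridge M - bridge M"
proof -
  have "(\<Sum>i\<in>{1,2,3}. gen i * gen j * gen i) = casimir * gen j - gen j" if j: "j \<in> {1,2,3}" for j
  proof -
    consider "j = 1" | "j = 2" | "j = 3" using j by auto
    thus ?thesis
      using sandwich_cyclic[OF imu_gen3 imu_gen1 imu_gen2 casimir_eq]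
        sandwich_cyclic[OF imu_gen1 imu_gen2 imu_gen3 casimir_cyclic(1)]
        sandwich_cyclic[OF imu_gen2 imu_gen3 imu_gen1 casimir_cyclic(2)]
      unfolding sum_colours by cases (simp_all add: ac_simps)
  qed
  hence "(\<Sum>j\<in>{1,2,3}. (\<Sum>i\<in>{1,2,3}. gen i * gen j * gen i) * M * gen j)
      = (\<Sum>j\<in>{1,2,3}. (casimir * gen j - gen j) * M * gen j)"
    by (intro sum.cong refl) simp
  also have "\<dots> = casimir * bridge M - bridge M"
    unfolding bridge_def left_diff_distrib sum_subtractf sum_distrib_left mult.assoc ..
  also have "(\<Sum>j\<in>{1,2,3}. (\<Sum>i\<in>{1,2,3}. gen i * gen j * gen i) * M * gen j) = opU_map bridge M"
    unfolding opU_map_def bridge_def sum_distrib_left sum_distrib_right mult.assoc by (rule sum.swap)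
  finally show ?thesis .
qed

section \<open>Polynomials in the bridge operator\<close>

text \<open>The value of \<open>P\<close> at \<open>y = bridge\<close>, in Horner form. Since
  \<open>bridge\<close> is applied to the argument of the tail, multiplication by \<open>y\<close>
  is precomposition with \<open>bridge\<close>, which is exactly how \<open>Y\<close> acts.\<close>

definition polyop :: "complex poly poly \<Rightarrow> rep_family \<Rightarrow> rep_family" where
  "polyop P = fold_coeffs (\<lambda>a f M. scal a * M + f (bridge M)) P (\<lambda>M. 0)"

lemma polyop_0 [simp]: "polyop 0 M = 0"
  by (simp add: polyop_def)

lemma polyop_pCons [simp]: "polyop (pCons a P) M = scal a * M + polyop P (bridge M)"
  by (cases "P = 0 \<and> a = 0") (auto simp: polyop_def)

lemma polyop_1 [simp]: "polyop 1 M = M"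
  unfolding one_pCons[where 'a="complex poly"] by simp

lemma polyop_add: "polyop (P + Q) M = polyop P M + polyop Q M"
  by (induction P Q arbitrary: M rule: poly_induct2) (simp_all add: scal_add algebra_simps)

lemma polyop_smult: "polyop (smult p P) M = scal p * polyop P M"
  by (induction P arbitrary: M) (simp_all add: scal_mult distrib_left mult.assoc)

lemma polyop_diff: "polyop (P - Q) M = polyop P M - polyop Q M"
  using polyop_add[of "P - Q" Q M] by simp

lemma polyop_sum: "polyop (sum f S) M = (\<Sum>x\<in>S. polyop (f x) M)"
  by (induction S rule: infinite_finite_induct) (simp_all add: polyop_add)

lemma polyop_const_mult: "polyop ([:p:] * P) M = scal p * polyop P M"
  by (simp add: polyop_smult)

lemma polyop_y_mult: "polyop ([:0, 1:] * P) M = polyop P (bridge M)"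
  by simp

lemma bridge_invariant: "invariant_map bridge"
proof (rule invariant_mapI)
  fix i :: nat and a assume "i \<in> {1,2,3}"
  from chord_invariant[OF this, of a]
  show "gen i * bridge a - bridge a * gen i = bridge (gen i * a - a * gen i)"
    unfolding bridge_def sum_distrib_left sum_distrib_right
    by (simp add: algebra_simps)
qed (simp_all add: bridge_def algebra_simps scal_left_commute)

lemma polyop_invariant: "invariant_map (polyop P)"
proof (induction P)
  case 0
  show ?case by (rule invariant_mapI) simp_all
next
  case (pCons a P)
  note IH = invariant_map_add[OF pCons(2)] invariant_map_scal[OF pCons(2)]
    invariant_map_diff[OF pCons(2)] invariant_map_commutator[OF pCons(2)]
  note br = invariant_map_add[OF bridge_invariant] invariant_map_scal[OF bridge_invariant]
    invariant_map_diff[OF bridge_invariant] invariant_map_commutator[OF bridge_invariant]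
  show ?case
  proof (rule invariant_mapI)
    fix i :: nat and M assume i: "i \<in> {1,2,3}"
    have "gen i * polyop (pCons a P) M - polyop (pCons a P) M * gen i
      = scal a * (gen i * M - M * gen i) + (gen i * polyop P (bridge M) - polyop P (bridge M) * gen i)"
      by (simp add: algebra_simps scal_left_commute)
    also have "\<dots> = polyop (pCons a P) (gen i * M - M * gen i)"
      by (simp add: IH(4)[OF i] br(4)[OF i])
    finally show "gen i * polyop (pCons a P) M - polyop (pCons a P) M * gen i
      = polyop (pCons a P) (gen i * M - M * gen i)" .
  next
    fix p M
    have "scal a * (scal p * M) = scal p * (scal a * M)" by (rule scal_left_commute)
    thus "polyop (pCons a P) (scal p * M) = scal p * polyop (pCons a P) M"
      by (simp add: IH br distrib_left)
  qed (simp add: IH br algebra_simps)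
qed

text \<open>On central elements \<open>bridge\<close> is multiplication by the Casimir, so
  \<open>y\<close> is specialised to \<open>c\<close>.\<close>

lemma polyop_scal: "polyop P (scal p) = scal (p * poly P [:0, 1:])"
proof (induction P arbitrary: p)
  case (pCons a P)
  have "bridge (scal p) = (\<Sum>j\<in>{1,2,3}. gen j * (gen j * scal p))"
    unfolding bridge_def mult.assoc by (simp add: scal_commute)
  also have "\<dots> = scal ([:0, 1:] * p)" unfolding casimir_sum scal_mult ..
  finally have "bridge (scal p) = scal ([:0, 1:] * p)" .
  thus ?case by (simp add: pCons scal_mult[symmetric] scal_add[symmetric] algebra_simps)
qed simp

text \<open>A relation rather than a function: that \<open>U\<close> sends a polynomial in
  \<open>y\<close> to such a polynomial is established only together with the value.\<close>

definition U_image :: "complex poly poly \<Rightarrow> complex poly poly \<Rightarrow> bool" where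
  "U_image P V \<longleftrightarrow> (\<forall>M. opU_map (polyop P) M = polyop V M)"

lemma U_image_add: "U_image P V \<Longrightarrow> U_image Q W \<Longrightarrow> U_image (P + Q) (V + W)"
  unfolding U_image_def by (simp add: opU_map_def polyop_add distrib_left sum.distrib)

lemma U_image_smult: "U_image P V \<Longrightarrow> U_image (smult p P) (smult p V)"
  unfolding U_image_def opU_map_def polyop_smult scal_left_commute sum_distrib_left[symmetric] by simp

lemma U_image_const_mult: "U_image P V \<Longrightarrow> U_image ([:p:] * P) ([:p:] * V)"
  using U_image_smult[of P V p] by simp

lemma U_image_diff: "U_image P V \<Longrightarrow> U_image Q W \<Longrightarrow> U_image (P - Q) (V - W)"
  using U_image_add[of P V "smult (-1) Q" "smult (-1) W"] U_image_smult[of Q W "-1"] by simp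

lemma U_image_sum: "(\<And>x. x \<in> S \<Longrightarrow> U_image (f x) (g x)) \<Longrightarrow> U_image (sum f S) (sum g S)"
proof (induction S rule: infinite_finite_induct)
  case (insert x S)
  thus ?case by (simp add: U_image_add)
qed (simp_all add: U_image_def opU_map_def)

abbreviation (input) yvar :: "complex poly poly" where "yvar \<equiv> [:0, 1:]"
abbreviation (input) cvar :: "complex poly poly" where "cvar \<equiv> [:[:0, 1:]:]"

lemma U_image_1: "U_image 1 cvar"
  using casimir_sum unfolding U_image_def opU_map_def by simp

lemma U_image_y: "U_image yvar (cvar * yvar - yvar)"
  unfolding U_image_def polyop_diff polyop_const_mult using opU_map_bridge
  by (simp add: opU_map_def)

text \<open>\<open>racah_relation\<close> solved for the image of \<open>y^2 P\<close>, so that the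
  images of \<open>P\<close> and \<open>y P\<close> determine it.\<close>

lemma U_image_square:
  assumes P: "U_image P V" and yP: "U_image (yvar * P) W"
  shows "U_image (yvar * (yvar * P))
    (2 * yvar * W - yvar * yvar * V + 2 * cvar * V + 2 * cvar * yvar * P - W - yvar * V
      - yvar * yvar * P - cvar * cvar * P)"
  unfolding U_image_def
proof
  fix M
  have eq: "2 * yvar * W - yvar * yvar * V + 2 * cvar * V + 2 * cvar * yvar * P - W - yvar * V
      - yvar * yvar * P - cvar * cvar * P
    = (yvar * W + yvar * W) - yvar * (yvar * V)
      + cvar * (V + V + yvar * P + yvar * P - cvar * P) - W - yvar * V - yvar * (yvar * P)"
    by algebra
  have 1: "opU_map (polyop P) N = polyop V N" "opU_map (\<lambda>a. polyop P (bridge a)) N = polyop W N" for N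
    using P yP unfolding U_image_def polyop_y_mult by auto
  have "opU_map (\<lambda>a. polyop P (bridge (bridge a))) M
    = (polyop W (bridge M) + polyop W (bridge M)) - polyop V (bridge (bridge M))
      + casimir * (polyop V M + polyop V M + polyop P (bridge M) + polyop P (bridge M) - casimir * polyop P M)
      - polyop W M - polyop V (bridge M) - polyop P (bridge (bridge M))"
    using racah_relation[OF polyop_invariant, of P M] unfolding 1 by (simp add: algebra_simps)
  thus "opU_map (polyop (yvar * (yvar * P))) M
    = polyop (2 * yvar * W - yvar * yvar * V + 2 * cvar * V + 2 * cvar * yvar * P - W - yvar * V
      - yvar * yvar * P - cvar * cvar * P) M"
    unfolding eq polyop_add polyop_diff polyop_const_mult polyop_y_mult .
qed

section \<open>The eigenvectors\<close>

text \<open>The claimed recurrence for \<open>Y\<close>, solved for its top term, with starting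
  values \<open>1\<close> and \<open>y\<close>.\<close>

fun eig :: "nat \<Rightarrow> complex poly poly" where
  "eig 0 = 1"
| "eig (Suc 0) = yvar"
| "eig (Suc (Suc n)) = (yvar - [:[:of_nat ((n + 1) * (n + 2)) / 4:]:]) * eig (Suc n)
     - [:coefK (Suc n):] * eig n"

lemma coefK_0: "coefK 0 = 0"
  by (simp add: coefK_def)

lemma eig_y:
  "yvar * eig n = eig (n + 1) + [:[:of_nat (n * (n + 1)) / 4:]:] * eig n
    + [:coefK n:] * (if n = 0 then 0 else eig (n - 1))"
proof (cases n)
  case 0
  thus ?thesis by (simp add: coefK_0)
next
  case (Suc m)
  have "y * f = ((y - b) * f - g) + b * f + g" for y b f g :: "complex poly poly"
    by (simp add: algebra_simps)
  hence "yvar * eig (Suc m) = eig (Suc (Suc m)) + [:[:of_nat ((m + 1) * (m + 2)) / 4:]:] * eig (Suc m)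
      + [:coefK (Suc m):] * eig m"
    unfolding eig.simps(3) .
  moreover have "Suc m * (Suc m + 1) = (m + 1) * (m + 2)" "Suc m + 1 = Suc (Suc m)" by simp_all
  ultimately show ?thesis unfolding Suc by (simp only: nat.distinct if_False diff_Suc_1)
qed

section \<open>Arithmetic of the recurrence coefficients\<close>

lemma poly_coefK:
  "poly (coefK n) t = (of_nat n)\<^sup>2 / (4 * (of_nat n)\<^sup>2 - 1) * (t - ((of_nat n)\<^sup>2 - 1) / 4)\<^sup>2"
  by (simp add: coefK_def c_minus_def)

lemma poly_c_minus: "poly (c_minus s) t = t - s"
  by (simp add: c_minus_def)

text \<open>The condition on the coefficients that makes the inductive step work. Both terms have
  denominator \<open>2 * n + 1\<close> left, and the numerator is a difference of squares whose two
  factors are \<open>t - 3 * n * (n + 1) / 4\<close> and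
  \<open>(2 * n + 1) * (t - n * (n + 1) / 4)\<close>.\<close>

lemma coefK_relation:
  "[:of_nat (2 * n + 3):] * coefK (n + 1) - [:2 * of_nat n - 1:] * coefK n
    = c_minus (3 * of_nat (n * (n + 1)) / 4) * c_minus (of_nat (n * (n + 1)) / 4)"
proof -
  define x :: complex where "x = of_nat n"
  have ne: "2 * x + 1 \<noteq> 0" "2 * x + 3 \<noteq> 0" "2 * x - 1 \<noteq> 0"
  proof -
    have "2 * x + 1 = of_int (2 * int n + 1)" "2 * x + 3 = of_int (2 * int n + 3)"
      "2 * x - 1 = of_int (2 * int n - 1)" by (simp_all add: x_def)
    moreover have "2 * int n + 1 \<noteq> 0" "2 * int n + 3 \<noteq> 0" "2 * int n - 1 \<noteq> 0" by presburger+
    ultimately show "2 * x + 1 \<noteq> 0" "2 * x + 3 \<noteq> 0" "2 * x - 1 \<noteq> 0" by (simp_all only: of_int_eq_0_iff not_False_eq_True)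
  qed
  have d: "4 * (x + 1)\<^sup>2 - 1 = (2 * x + 1) * (2 * x + 3)" "4 * x\<^sup>2 - 1 = (2 * x + 1) * (2 * x - 1)"
    by (simp_all add: power2_eq_square algebra_simps)
  have "poly ([:of_nat (2 * n + 3):] * coefK (n + 1) - [:2 * of_nat n - 1:] * coefK n) t
    = poly (c_minus (3 * of_nat (n * (n + 1)) / 4) * c_minus (of_nat (n * (n + 1)) / 4)) t" for t
  proof -
    have "(2 * x + 3) * ((x + 1)\<^sup>2 / (4 * (x + 1)\<^sup>2 - 1) * (t - ((x + 1)\<^sup>2 - 1) / 4)\<^sup>2)
       - (2 * x - 1) * (x\<^sup>2 / (4 * x\<^sup>2 - 1) * (t - (x\<^sup>2 - 1) / 4)\<^sup>2)
      = (((x + 1) * (t - ((x + 1)\<^sup>2 - 1) / 4))\<^sup>2 - (x * (t - (x\<^sup>2 - 1) / 4))\<^sup>2) / (2 * x + 1)"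
      unfolding d using ne by (simp add: power_mult_distrib diff_divide_distrib)
    also have "((x + 1) * (t - ((x + 1)\<^sup>2 - 1) / 4))\<^sup>2 - (x * (t - (x\<^sup>2 - 1) / 4))\<^sup>2
      = (2 * x + 1) * ((t - 3 * (x * (x + 1)) / 4) * (t - (x * (x + 1)) / 4))"
      by (simp add: power2_eq_square field_simps)
    finally have "(2 * x + 3) * ((x + 1)\<^sup>2 / (4 * (x + 1)\<^sup>2 - 1) * (t - ((x + 1)\<^sup>2 - 1) / 4)\<^sup>2)
       - (2 * x - 1) * (x\<^sup>2 / (4 * x\<^sup>2 - 1) * (t - (x\<^sup>2 - 1) / 4)\<^sup>2)
      = (t - 3 * (x * (x + 1)) / 4) * (t - (x * (x + 1)) / 4)" using ne by simp
    moreover have "of_nat (2 * n + 3) = 2 * x + 3" "of_nat (n + 1) = x + 1"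
      "of_nat (n * (n + 1)) = x * (x + 1)" by (simp_all add: x_def algebra_simps)
    moreover have "poly [:s:] t = s" for s by simp
    ultimately show ?thesis
      unfolding poly_diff poly_mult poly_coefK poly_c_minus x_def[symmetric] by (simp only:)
  qed
  thus ?thesis by (simp add: poly_eq_poly_eq_iff[symmetric] fun_eq_iff)
qed

lemma const_hom:
  "[:[:a + b:]:] = [:[:a:]:] + ([:[:b:]:] :: complex poly poly)"
  "[:[:a - b:]:] = [:[:a:]:] - ([:[:b:]:] :: complex poly poly)"
  "[:[:a * b:]:] = [:[:a:]:] * ([:[:b:]:] :: complex poly poly)"
  "[:[:1:]:] = (1 :: complex poly poly)"
  "[:[:numeral w:]:] = (numeral w :: complex poly poly)"
  by (simp_all add: one_pCons numeral_poly)

text \<open>The same relation with \<open>n\<close> and \<open>1/4\<close> as ring elements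
  \<open>\<nu>\<close> and \<open>q\<close>, as needed for division-free reasoning in the polynomial
  ring.\<close>

lemma coefK_relation':
  fixes n :: nat
  defines "\<nu> \<equiv> [:[:of_nat n:]:] :: complex poly poly" and "q \<equiv> [:[:1/4:]:]"
  shows "(2 * \<nu> + 3) * [:coefK (n + 1):] - (2 * \<nu> - 1) * [:coefK n:]
    = (cvar - 3 * q * \<nu> * (\<nu> + 1)) * (cvar - q * \<nu> * (\<nu> + 1))"
proof -
  have m: "[:p * p':] = [:p:] * ([:p':] :: complex poly poly)"
    "[:p - p':] = [:p:] - ([:p':] :: complex poly poly)" for p p' by simp_all
  have c: "[:c_minus z:] = cvar - [:[:z:]:]" for z by (simp add: c_minus_def)
  have "[:[:of_nat (2 * n + 3):] * coefK (n + 1) - [:2 * of_nat n - 1:] * coefK n:]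
    = [:c_minus (3 * (1/4 * of_nat n * (of_nat n + 1))) * c_minus (1/4 * of_nat n * (of_nat n + 1)):]"
    unfolding coefK_relation by (simp add: algebra_simps)
  thus ?thesis
    unfolding m c of_nat_add of_nat_mult of_nat_numeral const_hom \<nu>_def[symmetric] q_def[symmetric]
    by (simp add: mult.assoc)
qed

text \<open>The inductive step as a ring identity: \<open>E\<^sub>0\<close>,
  \<open>E\<^sub>1\<close>, \<open>E\<^sub>2\<close> are consecutive eigenvectors, and
  \<open>V\<close> and \<open>W\<close> are the images under \<open>U\<close> of
  \<open>E\<^sub>1\<close> and \<open>y * E\<^sub>1\<close>. The eigenvector before
  \<open>E\<^sub>0\<close> enters only through
  \<open>y * E\<^sub>0 - E\<^sub>1 - b \<nu> * E\<^sub>0\<close>. Once \<open>E\<close> eliminates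
  \<open>E\<^sub>0\<close>, the coefficients of \<open>E\<^sub>2\<close> and
  \<open>E\<^sub>1\<close> vanish separately.\<close>

lemma eig_step_identity:
  fixes y c \<nu> q K K' E\<^sub>0 E\<^sub>1 E\<^sub>2 :: "'a::idom"
  assumes b: "\<And>x. b x = q * (x * (x + 1))" and v: "\<And>x. v x = c - 2 * q * (x * (x + 1))"
  defines "W \<equiv> v (\<nu> + 2) * E\<^sub>2 + b (\<nu> + 1) * (v (\<nu> + 1) * E\<^sub>1) + K * (v \<nu> * E\<^sub>0)"
  defines "V \<equiv> v (\<nu> + 1) * E\<^sub>1"
  assumes q: "4 * q = 1"
    and K: "(2 * (\<nu> + 1) + 3) * K' - (2 * (\<nu> + 1) - 1) * K
      = (c - 3 * q * (\<nu> + 1) * (\<nu> + 1 + 1)) * (c - q * (\<nu> + 1) * (\<nu> + 1 + 1))"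
    and E: "K * E\<^sub>0 = y * E\<^sub>1 - b (\<nu> + 1) * E\<^sub>1 - E\<^sub>2"
  shows "(2 * y * W - y * y * V + 2 * c * V + 2 * c * y * E\<^sub>1 - W - y * V - y * y * E\<^sub>1 - c * c * E\<^sub>1)
      - b (\<nu> + 1) * W
      - K * (v (\<nu> + 1) * E\<^sub>1 + b \<nu> * (v \<nu> * E\<^sub>0) + v (\<nu> - 1) * (y * E\<^sub>0 - E\<^sub>1 - b \<nu> * E\<^sub>0))
      - b (\<nu> + 2) * (v (\<nu> + 2) * E\<^sub>2) - K' * (v (\<nu> + 1) * E\<^sub>1)
    = v (\<nu> + 3) * ((y - b (\<nu> + 2)) * E\<^sub>2 - K' * E\<^sub>1)"
proof -
  have d1: "v (\<nu> + 1) - v (\<nu> - 1) = - (2 * \<nu> + 1)" and d3: "v (\<nu> + 3) - v (\<nu> + 1) = - (2 * \<nu> + 5)"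
    using q unfolding v by algebra+
  have coeff2: "(2 * y - 1 - b (\<nu> + 1)) * (v (\<nu> + 2) - v \<nu>) + b \<nu> * v \<nu> + v (\<nu> - 1) * (y - b \<nu>)
      - b (\<nu> + 2) * v (\<nu> + 2) - v (\<nu> + 3) * (y - b (\<nu> + 2)) = 0"
    using q unfolding b v by algebra
  \<comment> \<open>The part of the coefficient of \<open>E\<^sub>1\<close> that is free of
    \<open>K\<close> and \<open>K'\<close>. It equals the right-hand side of the hypothesis
    \<open>K\<close>, while \<open>d1\<close> and \<open>d3\<close> produce the left-hand
    side.\<close>
  have "(2 * y - 1 - b (\<nu> + 1)) * (b (\<nu> + 1) * v (\<nu> + 1) + v \<nu> * (y - b (\<nu> + 1)))
      - y * y * v (\<nu> + 1) + 2 * c * v (\<nu> + 1) + 2 * c * y - y * v (\<nu> + 1) - y * y - c * c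
      - (b \<nu> * v \<nu> + v (\<nu> - 1) * (y - b \<nu>)) * (y - b (\<nu> + 1))
    = (c - 3 * q * (\<nu> + 1) * (\<nu> + 1 + 1)) * (c - q * (\<nu> + 1) * (\<nu> + 1 + 1))"
    using q unfolding b v by algebra
  hence coeff1: "(2 * y - 1 - b (\<nu> + 1)) * (b (\<nu> + 1) * v (\<nu> + 1) + v \<nu> * (y - b (\<nu> + 1)))
      - y * y * v (\<nu> + 1) + 2 * c * v (\<nu> + 1) + 2 * c * y - y * v (\<nu> + 1) - y * y - c * c
      - (b \<nu> * v \<nu> + v (\<nu> - 1) * (y - b \<nu>)) * (y - b (\<nu> + 1))
      - K * (v (\<nu> + 1) - v (\<nu> - 1)) + K' * (v (\<nu> + 3) - v (\<nu> + 1)) = 0"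
    using K unfolding d1 d3 by algebra
  show ?thesis using coeff1 coeff2 E unfolding W_def V_def by algebra
qed

text \<open>Strong induction. The recurrence expresses \<open>eig (m + 3)\<close> through
  \<open>y^2 * eig (m + 1)\<close> and terms whose images are known; \<open>U_image_square\<close>
  supplies the image of the square and \<open>eig_step_identity\<close> collapses the sum.\<close>

lemma U_image_eig: "U_image (eig n) ([:u n:] * eig n)"
proof -
  have u: "[:u m:] = cvar - 2 * [:[:1/4:]:] * ([:[:of_nat m:]:] * ([:[:of_nat m:]:] + 1))" for m
  proof -
    have "[:u m:] = cvar - [:[:2 * (1/4) * (of_nat m * (of_nat m + 1)):]:]"
      by (simp add: u_def c_minus_def algebra_simps)
    thus ?thesis unfolding const_hom .
  qed
  have b: "[:[:of_nat (m * (m + 1)) / 4 :: complex:]:] = [:[:1/4:]:] * ([:[:of_nat m:]:] * ([:[:of_nat m:]:] + 1))" for m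
  proof -
    have "of_nat (m * (m + 1)) / 4 = (1/4) * (of_nat m * (of_nat m + 1) :: complex)"
      by (simp add: algebra_simps)
    hence "[:[:of_nat (m * (m + 1)) / 4:]:] = [:[:(1/4) * (of_nat m * (of_nat m + 1) :: complex):]:]"
      by (simp only:)
    thus ?thesis unfolding const_hom .
  qed
  have q: "4 * [:[:1/4:]:] = (1 :: complex poly poly)"
  proof -
    have "[:[:4 * (1/4):]:] = [:[:1 :: complex:]:]" by simp
    thus ?thesis unfolding const_hom .
  qed
  show ?thesis
  proof (induction n rule: less_induct)
    case (less n)
    have "n = 0 \<or> n = 1 \<or> n = 2 \<or> (\<exists>m. n = m + 3)" by presburger
    then consider "n = 0" | "n = 1" | "n = 2" | m where "n = m + 3" by blast
    thus ?case
    proof cases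
      case 1
      thus ?thesis using U_image_1 by (simp add: u_def c_minus_def)
    next
      case 2
      have "[:u 1:] * yvar = cvar * yvar - yvar" by (simp add: u_def c_minus_def one_pCons)
      thus ?thesis using U_image_y 2 by simp
    next
      \<comment> \<open>For \<open>n = 2\<close> the general step would involve an eigenvector of
        index \<open>-1\<close>; instead the images of \<open>1\<close> and \<open>y\<close> are
        used directly.\<close>
      case 3
      have "U_image (yvar * 1) (cvar * yvar - yvar)" using U_image_y by simp
      from U_image_square[OF U_image_1 this] have sq: "U_image (yvar * yvar) (2 * yvar * (cvar * yvar - yvar)
          - yvar * yvar * cvar + 2 * cvar * cvar + 2 * cvar * yvar - (cvar * yvar - yvar) - yvar * cvar
          - yvar * yvar - cvar * cvar)" by (simp only: mult_1_right)
      let ?q = "[:[:1/4:]:] :: complex poly poly"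
      define K where "K = [:coefK 1:]"
      have b1: "[:[:of_nat ((0 + 1) * (0 + 2)) / 4:]:] = 2 * ?q"
        unfolding const_hom(3)[symmetric] const_hom(5)[symmetric] by simp
      have K: "3 * K = cvar * cvar"
        using coefK_relation'[of 0] by (simp only: coefK_0 K_def) (simp del: mult_pCons_left mult_pCons_right)
      have eig2: "eig 2 = yvar * yvar - 2 * ?q * yvar - K * 1"
      proof -
        have "eig 2 = eig (Suc (Suc 0))" by (simp only: numeral_2_eq_2)
        thus ?thesis unfolding eig.simps(3) b1 K_def by (simp only: eig.simps One_nat_def left_diff_distrib)
      qed
      have q2: "U_image (2 * ?q * yvar) (2 * ?q * (cvar * yvar - yvar))"
        unfolding const_hom(5)[symmetric] const_hom(3)[symmetric]
        by (intro U_image_const_mult U_image_y)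
      have u2: "[:u 2:] = cvar - 3"
        unfolding u_def c_minus_def by (simp add: numeral_poly)
      have "U_image (eig 2) ((2 * yvar * (cvar * yvar - yvar)
          - yvar * yvar * cvar + 2 * cvar * cvar + 2 * cvar * yvar - (cvar * yvar - yvar) - yvar * cvar
          - yvar * yvar - cvar * cvar) - 2 * ?q * (cvar * yvar - yvar) - K * cvar)"
        unfolding eig2 by (intro U_image_diff sq q2 U_image_const_mult[of 1 cvar "coefK 1", folded K_def] U_image_1)
      also have "(2 * yvar * (cvar * yvar - yvar)
          - yvar * yvar * cvar + 2 * cvar * cvar + 2 * cvar * yvar - (cvar * yvar - yvar) - yvar * cvar
          - yvar * yvar - cvar * cvar) - 2 * ?q * (cvar * yvar - yvar) - K * cvar = [:u 2:] * eig 2"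
        unfolding u2 eig2 using q K by algebra
      finally show ?thesis unfolding 3 .
    next
      case (4 m)
      let ?q = "[:[:1/4:]:] :: complex poly poly"
      define \<nu> :: "complex poly poly" where "\<nu> = [:[:of_nat m:]:]"
      have \<nu>: "[:[:of_nat (m + k):]:] = \<nu> + [:[:of_nat k:]:]" for k
        unfolding of_nat_add const_hom \<nu>_def ..
      have num: "[:[:of_nat 1:]:] = (1 :: complex poly poly)" "[:[:of_nat 2:]:] = (2 :: complex poly poly)"
        "[:[:of_nat 3:]:] = (3 :: complex poly poly)"
        by (simp_all add: const_hom)
      define b where "b = (\<lambda>x. ?q * (x * (x + 1)))"
      define v where "v = (\<lambda>x. cvar - 2 * ?q * (x * (x + 1)))"
      have b_eq: "b x = ?q * (x * (x + 1))" and v_eq: "v x = cvar - 2 * ?q * (x * (x + 1))" for x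
        unfolding b_def v_def by (rule refl)+
      define K where "K = [:coefK (m + 1):]"
      define K' where "K' = [:coefK (m + 2):]"
      have bs: "[:[:of_nat (m * (m + 1)) / 4:]:] = b \<nu>"
        "[:[:of_nat ((m + 1) * (m + 1 + 1)) / 4:]:] = b (\<nu> + 1)"
        "[:[:of_nat ((m + 2) * (m + 2 + 1)) / 4:]:] = b (\<nu> + 2)"
        unfolding b b_def \<nu> num by (simp_all only: \<nu>_def)
      have vs: "[:u m:] = v \<nu>" "[:u (m + 1):] = v (\<nu> + 1)" "[:u (m + 2):] = v (\<nu> + 2)" "[:u (m + 3):] = v (\<nu> + 3)"
        unfolding u v_def \<nu> num by (simp_all only: \<nu>_def)
      note IH = less.IH[of m, unfolded vs] less.IH[of "m + 1", unfolded vs] less.IH[of "m + 2", unfolded vs]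
      have E0: "U_image (eig m) (v \<nu> * eig m)" and E1: "U_image (eig (m + 1)) (v (\<nu> + 1) * eig (m + 1))"
        and E2: "U_image (eig (m + 2)) (v (\<nu> + 2) * eig (m + 2))"
        using IH 4 by auto
      have r0: "yvar * eig m = eig (m + 1) + b \<nu> * eig m + (yvar * eig m - eig (m + 1) - b \<nu> * eig m)" by simp
      have r1: "yvar * eig (m + 1) = eig (m + 2) + b (\<nu> + 1) * eig (m + 1) + K * eig m"
        using eig_y[of "m + 1"] unfolding bs K_def by simp
      have r2: "eig (m + 3) = yvar * eig (m + 2) - b (\<nu> + 2) * eig (m + 2) - K' * eig (m + 1)"
      proof -
        have "m + 2 + 1 = m + 3" "m + 2 - 1 = m + 1" "(m + 2 = 0) = False" by simp_all
        note idx = this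
        have "x = p - s - t" if "p = x + s + t" for x p s t :: "complex poly poly" using that by simp
        moreover have "yvar * eig (m + 2) = eig (m + 3) + b (\<nu> + 2) * eig (m + 2) + K' * eig (m + 1)"
          using eig_y[of "m + 2"] unfolding bs K'_def unfolding idx if_False .
        ultimately show ?thesis by blast
      qed
      \<comment> \<open>This expression is the lower neighbour of \<open>eig m\<close> times
        \<open>coefK m\<close>. It is zero for \<open>m = 0\<close>, so in both cases it may be
        given the eigenvalue of index \<open>m - 1\<close>.\<close>
      have prev: "U_image (yvar * eig m - eig (m + 1) - b \<nu> * eig m)
          (v (\<nu> - 1) * (yvar * eig m - eig (m + 1) - b \<nu> * eig m))"
      proof -
        have eq: "yvar * eig m - eig (m + 1) - b \<nu> * eig m = [:coefK m:] * (if m = 0 then 0 else eig (m - 1))"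
          using eig_y[of m] unfolding bs by simp
        show ?thesis
        proof (cases m)
          case 0
          thus ?thesis unfolding eq by (simp add: U_image_def opU_map_def)
        next
          case (Suc k)
          have "[:[:of_nat k:]:] = \<nu> - 1" unfolding \<nu>_def Suc by (simp add: one_pCons)
          hence "[:u k:] = v (\<nu> - 1)" unfolding u v_def by simp
          hence "U_image (eig k) (v (\<nu> - 1) * eig k)" using less.IH[of k] 4 Suc by simp
          from U_image_const_mult[OF this, of "coefK m"] show ?thesis
            unfolding eq using Suc
            by (simp only: nat.distinct if_False diff_Suc_1 mult.left_commute[of "v (\<nu> - 1)"])
        qed
      qed
      have bE: "U_image (b \<nu> * P) (b \<nu> * V)" "U_image (b (\<nu> + 1) * P) (b (\<nu> + 1) * V)"
        "U_image (b (\<nu> + 2) * P) (b (\<nu> + 2) * V)" if "U_image P V" for P V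
        unfolding bs[symmetric] using U_image_const_mult[OF that] by blast+
      have KE: "U_image (K * P) (K * V)" "U_image (K' * P) (K' * V)" if "U_image P V" for P V
        unfolding K_def K'_def using U_image_const_mult[OF that] by blast+
      have y0: "U_image (yvar * eig m) (v (\<nu> + 1) * eig (m + 1) + b \<nu> * (v \<nu> * eig m)
          + v (\<nu> - 1) * (yvar * eig m - eig (m + 1) - b \<nu> * eig m))"
        by (subst r0) (intro U_image_add E1 bE E0 prev)
      have y1: "U_image (yvar * eig (m + 1))
          (v (\<nu> + 2) * eig (m + 2) + b (\<nu> + 1) * (v (\<nu> + 1) * eig (m + 1)) + K * (v \<nu> * eig m))"
        unfolding r1 by (intro U_image_add E2 bE E1 KE E0)
      \<comment> \<open>The term \<open>y * eig (m + 2)\<close> is expanded by the recurrence once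
        more, so that \<open>y^2 * eig (m + 1)\<close> appears.\<close>
      have r3: "eig (m + 3) = yvar * (yvar * eig (m + 1)) - b (\<nu> + 1) * (yvar * eig (m + 1))
          - K * (yvar * eig m) - b (\<nu> + 2) * eig (m + 2) - K' * eig (m + 1)"
      proof -
        have "p - d - f = x - s - t - d - f" if "x = p + s + t" for p d f x s t :: "complex poly poly"
          using that by simp
        moreover have "yvar * (yvar * eig (m + 1))
            = yvar * eig (m + 2) + b (\<nu> + 1) * (yvar * eig (m + 1)) + K * (yvar * eig m)"
          by (subst r1) (simp only: distrib_left mult.left_commute[of yvar])
        ultimately show ?thesis unfolding r2 by blast
      qed
      have rel: "(2 * (\<nu> + 1) + 3) * K' - (2 * (\<nu> + 1) - 1) * K
          = (cvar - 3 * ?q * (\<nu> + 1) * (\<nu> + 1 + 1)) * (cvar - ?q * (\<nu> + 1) * (\<nu> + 1 + 1))"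
        using coefK_relation'[of "m + 1"] unfolding \<nu> num K_def K'_def
        by (simp only: add.assoc one_add_one)
      have K0: "K * eig m = yvar * eig (m + 1) - b (\<nu> + 1) * eig (m + 1) - eig (m + 2)"
      proof -
        have "x = p + s + x - s - p" for p s x :: "complex poly poly" by (simp add: algebra_simps)
        thus ?thesis unfolding r1 .
      qed
      have r4: "eig (m + 3) = (yvar - b (\<nu> + 2)) * eig (m + 2) - K' * eig (m + 1)"
        unfolding r2 left_diff_distrib ..
      have "U_image (eig (m + 3)) (v (\<nu> + 3) * ((yvar - b (\<nu> + 2)) * eig (m + 2) - K' * eig (m + 1)))"
        unfolding eig_step_identity[OF b_eq v_eq q rel K0, symmetric]
        by (subst r3) (intro U_image_diff U_image_square[OF E1 y1] bE KE y0 y1 E2 E1)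
      thus ?thesis unfolding 4 vs r4[symmetric] .
    qed
  qed
qed

text \<open>At \<open>y = c\<close> the three-term recurrence is solved by a two-term one, because
  \<open>coefK (n + 1)\<close> contains the square of \<open>c - n * (n + 2) / 4\<close>. The
  resulting product shows that the values at \<open>y = c\<close> are nonzero.\<close>

lemma eig_ratio:
  "poly (eig (Suc n)) [:0, 1:]
    = smult ((of_nat n + 1) / (2 * of_nat n + 1)) (c_minus (of_nat (n * (n + 2)) / 4)) * poly (eig n) [:0, 1:]"
proof (induction n)
  case 0
  show ?case by (simp add: c_minus_def)
next
  case (Suc n)
  define x :: complex where "x = of_nat n"
  let ?r = "\<lambda>n. smult ((of_nat n + 1) / (2 * of_nat n + 1)) (c_minus (of_nat (n * (n + 2)) / 4))"
  have ne: "2 * x + 1 \<noteq> 0" "2 * x + 3 \<noteq> 0"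
  proof -
    have "2 * x + 1 = of_nat (2 * n + 1)" "2 * x + 3 = of_nat (2 * n + 3)" by (simp_all add: x_def)
    moreover have "2 * n + 1 \<noteq> 0" "2 * n + 3 \<noteq> 0" by presburger+
    ultimately show "2 * x + 1 \<noteq> 0" "2 * x + 3 \<noteq> 0" by (simp_all only: of_nat_eq_0_iff not_False_eq_True)
  qed
  have K: "([:0, 1:] - [:of_nat ((n + 1) * (n + 2)) / 4:]) * ?r n - coefK (Suc n) = ?r (Suc n) * ?r n"
  proof -
    have "poly (([:0, 1:] - [:of_nat ((n + 1) * (n + 2)) / 4:]) * ?r n - coefK (Suc n)) t
      = poly (?r (Suc n) * ?r n) t" for t
    proof -
      define f where "f = (x + 1) / (2 * x + 1) * (t - x * (x + 2) / 4)"
      have d: "4 * (x + 1)\<^sup>2 - 1 = (2 * x + 1) * (2 * x + 3)" "(x + 1)\<^sup>2 - 1 = x * (x + 2)"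
        by (simp_all add: power2_eq_square algebra_simps)
      have "(x + 1)\<^sup>2 / (4 * (x + 1)\<^sup>2 - 1) * (t - ((x + 1)\<^sup>2 - 1) / 4)\<^sup>2
        = (x + 1) / (2 * x + 3) * (t - x * (x + 2) / 4) * f"
        unfolding d f_def by (simp add: power2_eq_square mult_ac)
      moreover have "t - (x + 1) * (x + 2) / 4 - (x + 1) / (2 * x + 3) * (t - x * (x + 2) / 4)
        = (x + 2) / (2 * x + 3) * (t - (x + 1) * (x + 3) / 4)"
      proof -
        have "a - b / d * f = g / d * h" if "d \<noteq> 0" "d * a - b * f = g * h" for a b d f g h :: complex
          using that by (simp add: field_simps)
        note * = this[OF ne(2)]
        show ?thesis by (rule *) (simp add: field_simps)
      qed
      ultimately have "(t - (x + 1) * (x + 2) / 4) * f - (x + 1)\<^sup>2 / (4 * (x + 1)\<^sup>2 - 1) * (t - ((x + 1)\<^sup>2 - 1) / 4)\<^sup>2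
        = (x + 2) / (2 * x + 3) * (t - (x + 1) * (x + 3) / 4) * f"
        by (metis left_diff_distrib)
      moreover have "of_nat ((n + 1) * (n + 2)) = (x + 1) * (x + 2)" "of_nat (Suc n) = x + 1"
        "of_nat (n * (n + 2)) = x * (x + 2)" "of_nat (Suc n * (Suc n + 2)) = (x + 1) * (x + 3)"
        by (simp_all add: x_def algebra_simps)
      moreover have "x + 1 + 1 = x + 2" "2 * (x + 1) + 1 = 2 * x + 3" by simp_all
      moreover have "poly ([:0, 1:] - [:s:]) t = t - s" for s by simp
      ultimately show ?thesis
        unfolding poly_diff[of "_ * _"] poly_mult poly_smult poly_coefK poly_c_minus x_def[symmetric]
        by (simp only: f_def)
    qed
    thus ?thesis by (simp add: poly_eq_poly_eq_iff[symmetric] fun_eq_iff)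
  qed
  have "poly (eig (Suc (Suc n))) [:0, 1:]
    = (([:0, 1:] - [:of_nat ((n + 1) * (n + 2)) / 4:]) * ?r n - coefK (Suc n)) * poly (eig n) [:0, 1:]"
    unfolding eig.simps poly_diff poly_mult Suc.IH by (simp add: algebra_simps)
  thus ?case unfolding K Suc.IH by (simp only: mult.assoc)
qed

section \<open>Shares as invariant maps\<close>

definition pairing :: "(rep_family \<Rightarrow> rep_family) \<Rightarrow> share \<Rightarrow> rep_family" where
  "pairing T H = colsum (set (fst H) \<union> set (snd H)) (\<lambda>\<psi>. T (word \<psi> (fst H)) * word \<psi> (snd H))"

lemma pairing_lincomb:
  "pairing (\<lambda>M. scal p * T M + T' M) H = scal p * pairing T H + pairing T' H"
  unfolding pairing_def distrib_right colsum_add mult.assoc colsum_mult_left[symmetric] ..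

lemma pairing_zero: "pairing (\<lambda>M. 0) H = 0"
  unfolding pairing_def colsum_def by simp

text \<open>Even and odd labels keep the chords of the two shares apart, so a colouring of the join
  is a pair of colourings. Summing first over those of \<open>I\<close> turns the word between its
  strands into the argument of \<open>transfer_op I\<close>.\<close>

lemma diagram_sum_join: "diagram_sum (join I H) = pairing (transfer_op I) H"
proof -
  obtain A B where I: "I = (A, B)" by (cases I)
  obtain P Q where H: "H = (P, Q)" by (cases H)
  define f :: "nat \<Rightarrow> nat" where "f = (\<lambda>l. 2 * l)"
  define g :: "nat \<Rightarrow> nat" where "g = (\<lambda>l. 2 * l + 1)"
  have inj: "inj f" "inj g" by (auto simp: f_def g_def inj_def)
  let ?S = "set A \<union> set B" and ?S' = "set P \<union> set Q"
  have disj: "f ` ?S \<inter> g ` ?S' = {}" unfolding f_def g_def by (auto, presburger+)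
  have set: "set (join I H) = f ` ?S \<union> g ` ?S'"
    unfolding join_def I H f_def g_def by auto
  have "diagram_sum (join I H) = colsum (f ` ?S \<union> g ` ?S') (\<lambda>\<phi>. word (\<phi> \<circ> f) A * word (\<phi> \<circ> g) P
      * word (\<phi> \<circ> f) B * word (\<phi> \<circ> g) Q)"
    unfolding diagram_sum_def set
    by (simp add: join_def I H word_map f_def g_def mult.assoc)
  also have "\<dots> = colsum (f ` ?S) (\<lambda>\<phi>. colsum (g ` ?S') (\<lambda>\<psi>. word (\<phi> \<circ> f) A * word (\<psi> \<circ> g) P
      * word (\<phi> \<circ> f) B * word (\<psi> \<circ> g) Q))"
    by (rule colsum_union[OF _ disj])
       (auto simp: depends_on_def intro!: arg_cong2[of _ _ _ _ "(*)"] word_cong)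
  also have "\<dots> = colsum (f ` ?S) (\<lambda>\<phi>. colsum ?S' (\<lambda>\<psi>. word (\<phi> \<circ> f) A * word \<psi> P
      * word (\<phi> \<circ> f) B * word \<psi> Q))"
    by (intro colsum_cong colsum_image inj)
       (auto simp: depends_on_def intro!: arg_cong2[of _ _ _ _ "(*)"] word_cong)
  also have "\<dots> = colsum ?S (\<lambda>\<phi>. colsum ?S' (\<lambda>\<psi>. word \<phi> A * word \<psi> P * word \<phi> B * word \<psi> Q))"
    by (intro colsum_image inj)
       (auto simp: depends_on_def intro!: arg_cong2[of _ _ _ _ "(*)"] word_cong colsum_cong)
  also have "\<dots> = colsum ?S' (\<lambda>\<psi>. colsum ?S (\<lambda>\<phi>. word \<phi> A * word \<psi> P * word \<phi> B * word \<psi> Q))"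
    unfolding colsum_def by (rule sum.swap)
  also have "\<dots> = pairing (transfer_op I) H"
    unfolding pairing_def transfer_op_def colsum_mult_right I H by simp
  finally show ?thesis .
qed

lemma join_chords:
  assumes "is_share I" "is_share H"
  shows "\<forall>l\<in>set (join I H). count_list (join I H) l = 2"
proof
  have inj: "inj (\<lambda>l::nat. 2 * l)" "inj (\<lambda>l::nat. 2 * l + 1)" by (auto simp: inj_def)
  have even: "count_list (map (\<lambda>l. 2 * l + 1) D) (2 * l) = 0"
    and odd: "count_list (map (\<lambda>l. 2 * l) D) (2 * l + 1) = 0" for D and l :: nat
    by (auto simp: count_list_0_iff) presburger+
  note count = count_list_map_conv[OF inj(1)] count_list_map_conv[OF inj(2)] even odd
  fix l assume "l \<in> set (join I H)"
  then consider l' where "l = 2 * l'" "l' \<in> set (fst I @ snd I)"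
    | l' where "l = 2 * l' + 1" "l' \<in> set (fst H @ snd H)"
    unfolding join_def by auto
  thus "count_list (join I H) l = 2"
  proof cases
    case 1
    thus ?thesis using assms(1) unfolding join_def is_share_def 1(1) count_list_append count by auto
  next
    case 2
    thus ?thesis using assms(2) unfolding join_def is_share_def 2(1) count_list_append count by auto
  qed
qed

definition linear_op :: "A2 \<Rightarrow> rep_family \<Rightarrow> rep_family" where
  "linear_op L M = (\<Sum>(a, I)\<leftarrow>L. scal [:a:] * transfer_op I M)"

lemma scal_wlin:
  assumes "\<forall>(a, I)\<in>set L. is_share I" "is_share H"
  shows "scal (wlin L H) = pairing (linear_op L) H"
  using assms(1)
proof (induction L)
  case Nil
  show ?case unfolding linear_op_def by (simp add: wlin_def pairing_zero)
next
  case (Cons x L)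
  obtain a I where x: "x = (a, I)" by (cases x)
  have "scal (wlin (x # L) H) = scal [:a:] * scal (w_sl2 (join I H)) + scal (wlin L H)"
    unfolding wlin_def x by (simp add: scal_add flip: scal_mult)
  also have "\<dots> = scal [:a:] * pairing (transfer_op I) H + pairing (linear_op L) H"
    using Cons assms(2) x by (simp add: scal_w_sl2 join_chords diagram_sum_join)
  also have "\<dots> = pairing (linear_op (x # L)) H"
    unfolding pairing_lincomb[symmetric] linear_op_def x by simp
  finally show ?case .
qed

lemma share_sim_iff:
  assumes "\<forall>(a, I)\<in>set L. is_share I" "\<forall>(a, I)\<in>set L'. is_share I"
  shows "L \<sim>\<^sub>S L' \<longleftrightarrow> (\<forall>H. is_share H \<longrightarrow> pairing (linear_op L) H = pairing (linear_op L') H)"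
  unfolding share_sim_def
  by (intro all_cong imp_cong refl) (simp add: scal_inject[symmetric] scal_wlin[OF assms(1)] scal_wlin[OF assms(2)])

section \<open>Adding chords to shares\<close>

lemma fresh_notin: "fresh S \<notin> set (fst S) \<union> set (snd S)"
proof
  assume "fresh S \<in> set (fst S) \<union> set (snd S)"
  hence "fresh S \<le> Max (insert 0 (set (fst S @ snd S)))" by (intro Max_ge) auto
  thus False by (simp add: fresh_def)
qed

text \<open>Only multiplicities of labels matter, so one statement serves every position in which a
  chord is added.\<close>

lemma is_share_add_chord:
  assumes "is_share (A, B)" "N \<notin> set A \<union> set B"
    and "\<And>l. count_list (A' @ B') l = count_list (A @ B) l + (if l = N then 2 else 0)"
  shows "is_share (A', B')"
  unfolding is_share_def fst_conv snd_conv
proof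
  fix l assume "l \<in> set (A' @ B')"
  hence "count_list (A' @ B') l \<noteq> 0" by (simp only: count_list_0_iff not_not)
  hence "l = N \<or> l \<in> set (A @ B)" unfolding assms(3) by (auto simp: count_list_0_iff split: if_splits)
  thus "count_list (A' @ B') l = 2"
  proof
    assume "l = N"
    thus ?thesis unfolding assms(3) using assms(2) by simp
  next
    assume "l \<in> set (A @ B)"
    thus ?thesis unfolding assms(3) using assms(1,2) by (auto simp: is_share_def)
  qed
qed

text \<open>When the colour of the new chord is split off, its ends become factors
  \<open>gen j\<close> outside or next to the argument. In the fourth case both stand next to the
  argument on the same side and give the Casimir.\<close>

lemma transfer_op_add_chord:
  assumes "N \<notin> set A \<union> set B"
  shows "transfer_op (N # A @ [N], B) = opU_map (transfer_op (A, B))" (is ?U)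
    and "transfer_op (A @ [N], B @ [N]) = opX_map (transfer_op (A, B))" (is ?X)
    and "transfer_op (A @ [N], N # B) M = transfer_op (A, B) (bridge M)" (is ?Y)
    and "transfer_op (A @ [N, N], B) M = transfer_op (A, B) (casimir * M)" (is ?C)
proof -
  have set: "set (fst (N # A @ [N], B)) \<union> set (snd (N # A @ [N], B)) = insert N (set A \<union> set B)"
    "set (fst (A @ [N], B @ [N])) \<union> set (snd (A @ [N], B @ [N])) = insert N (set A \<union> set B)"
    "set (fst (A @ [N], N # B)) \<union> set (snd (A @ [N], N # B)) = insert N (set A \<union> set B)"
    "set (fst (A @ [N, N], B)) \<union> set (snd (A @ [N, N], B)) = insert N (set A \<union> set B)" by auto
  have N: "N \<notin> set A" "N \<notin> set B" using assms by auto
  show ?U ?X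
    unfolding fun_eq_iff transfer_op_def set colsum_insert[OF assms] opU_map_def opX_map_def
      colsum_mult_left colsum_mult_right
    using N by (auto intro!: sum.cong colsum_cong simp: mult.assoc)
  show ?Y
    unfolding transfer_op_def set colsum_insert[OF assms] bridge_def sum_distrib_left sum_distrib_right
      colsum_sum[symmetric]
    using N by (auto intro!: sum.cong colsum_cong simp: mult.assoc)
  show ?C
    unfolding transfer_op_def set colsum_insert[OF assms] casimir_sum[symmetric] sum_distrib_left sum_distrib_right
      colsum_sum[symmetric]
    using N by (auto intro!: sum.cong colsum_cong simp: mult.assoc)
qed

lemma is_share_ops:
  assumes "is_share I"
  shows "is_share (opU1 I)" "is_share (opX1 I)" "is_share (opY1 I)"
  unfolding opU1_def opX1_def opY1_def Let_def
  by (rule is_share_add_chord[of "fst I" "snd I" "fresh I"]; use assms fresh_notin[of I] in simp)+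

lemma transfer_op_ops:
  "transfer_op (opU1 I) M = opU_map (transfer_op I) M"
  "transfer_op (opX1 I) M = opX_map (transfer_op I) M"
  "transfer_op (opY1 I) M = transfer_op I (bridge M)"
  unfolding opU1_def opX1_def opY1_def Let_def
  using transfer_op_add_chord[OF fresh_notin, of I] by simp_all

lemma linear_op_ops:
  "linear_op (opU L) M = opU_map (linear_op L) M"
  "linear_op (opX L) M = opX_map (linear_op L) M"
  "linear_op (opY L) M = linear_op L (bridge M)"
proof -
  show "linear_op (opU L) M = opU_map (linear_op L) M"
    by (induction L) (auto simp: linear_op_def opU_def linop_def opU_map_def transfer_op_ops
      algebra_simps scal_left_commute)
  show "linear_op (opX L) M = opX_map (linear_op L) M"
    by (induction L) (auto simp: linear_op_def opX_def linop_def opX_map_def transfer_op_ops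
      algebra_simps scal_left_commute)
  show "linear_op (opY L) M = linear_op L (bridge M)"
    by (induction L) (auto simp: linear_op_def opY_def linop_def transfer_op_ops)
qed

section \<open>Monomial shares and their linear combinations\<close>

lemma mono_simps:
  "Defs.mono 0 0 = ([], [])"
  "Defs.mono (Suc i) 0 = (fst (Defs.mono i 0) @ [i, i], [])"
  "Defs.mono i (Suc j) = (fst (Defs.mono i j) @ [i + j], (i + j) # snd (Defs.mono i j))"
  by (simp_all add: Defs.mono_def)

lemma mono_labels: "l \<in> set (fst (Defs.mono i j)) \<union> set (snd (Defs.mono i j)) \<Longrightarrow> l < i + j"
  by (auto simp: Defs.mono_def)

lemma mono_0: "Defs.mono i 0 = (fst (Defs.mono i 0), [])"
  by (simp add: Defs.mono_def)

lemma is_share_mono: "is_share (Defs.mono i j)"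
proof (induction j)
  case 0
  show ?case
  proof (induction i)
    case (Suc i)
    have "is_share (fst (Defs.mono i 0), [])" using Suc mono_0[of i] by simp
    thus ?case unfolding mono_simps
      by (rule is_share_add_chord[of _ _ i]) (use mono_labels[of i i 0] in auto)
  qed (simp add: mono_simps is_share_def)
next
  case (Suc j)
  show ?case unfolding mono_simps
    by (rule is_share_add_chord[of "fst (Defs.mono i j)" "snd (Defs.mono i j)" "i + j"])
       (use Suc mono_labels[of "i + j" i j] in auto)
qed

text \<open>The second strand lists the bridges in reverse, so they are nested around the argument
  and compose to a power of \<open>bridge\<close>; each isolated arch contributes one factor
  \<open>c\<close>.\<close>

lemma transfer_op_mono: "transfer_op (Defs.mono i j) M = casimir ^ i * (bridge ^^ j) M"
proof (induction j arbitrary: M)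
  case 0
  show ?case
  proof (induction i arbitrary: M)
    case 0
    show ?case by (simp add: mono_simps transfer_op_def colsum_empty)
  next
    case (Suc i)
    have "transfer_op (Defs.mono (Suc i) 0) M = transfer_op (Defs.mono i 0) (casimir * M)"
      using transfer_op_add_chord(4)[of i "fst (Defs.mono i 0)" "[]" M] mono_labels[of i i 0]
      unfolding mono_simps mono_0[of i, symmetric] by auto
    thus ?case unfolding Suc by (simp add: power_Suc2 mult.assoc del: power_Suc)
  qed
next
  case (Suc j)
  have "transfer_op (Defs.mono i (Suc j)) M = transfer_op (Defs.mono i j) (bridge M)"
    using transfer_op_add_chord(3)[of "i + j" "fst (Defs.mono i j)" "snd (Defs.mono i j)" M]
      mono_labels[of "i + j" i j] by (auto simp: mono_simps)
  thus ?case unfolding Suc by (simp add: funpow_swap1)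
qed

lemma is_share_rep: "\<forall>(a, I)\<in>set (rep P). is_share I"
  unfolding rep_def using is_share_mono by auto

lemma is_share_op_rep:
  "\<forall>(a, I)\<in>set (opU (rep P)). is_share I"
  "\<forall>(a, I)\<in>set (opX (rep P)). is_share I"
  "\<forall>(a, I)\<in>set (opY (rep P)). is_share I"
  using is_share_rep[of P] unfolding opU_def opX_def opY_def linop_def by (auto simp: is_share_ops)

lemma scal_expand: "scal p = (\<Sum>i<Suc (degree p). scal [:coeff p i:] * casimir ^ i)"
proof -
  have m: "scal (monom a i) = scal [:a:] * casimir ^ i" for a i
  proof (induction i)
    case (Suc i)
    have "monom a (Suc i) = [:0, 1:] * monom a i" by (simp add: monom_Suc)
    hence "scal (monom a (Suc i)) = casimir * (scal [:a:] * casimir ^ i)" by (simp only: scal_mult Suc)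
    also have "\<dots> = scal [:a:] * (casimir * casimir ^ i)" by (rule scal_left_commute)
    finally show ?case by simp
  qed (simp add: monom_0)
  have s: "scal (sum f S) = (\<Sum>x\<in>S. scal (f x))" for f and S :: "nat set"
    by (induction S rule: infinite_finite_induct) (simp_all add: scal_add)
  have "scal p = scal (\<Sum>i\<le>degree p. monom (coeff p i) i)" by (simp add: poly_as_sum_of_monoms)
  thus ?thesis unfolding s m lessThan_Suc_atMost .
qed

lemma polyop_expand: "polyop P M = (\<Sum>j<Suc (degree P). scal (coeff P j) * (bridge ^^ j) M)"
proof -
  have m: "polyop (monom a i) M = scal a * (bridge ^^ i) M" for a i M
    by (induction i arbitrary: M) (simp_all add: monom_0 monom_Suc funpow_swap1)
  have "polyop P M = polyop (\<Sum>i\<le>degree P. monom (coeff P i) i) M" by (simp add: poly_as_sum_of_monoms)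
  thus ?thesis unfolding polyop_sum m lessThan_Suc_atMost .
qed

lemma linear_op_rep: "linear_op (rep P) M = polyop P M"
proof -
  have upt: "(\<Sum>i\<leftarrow>[0..<n]. f i) = (\<Sum>i<n. f i)" for f :: "nat \<Rightarrow> rep_family" and n
    by (simp add: interv_sum_list_conv_sum_set_nat lessThan_atLeast0)
  have conc: "(\<Sum>x\<leftarrow>concat (map F js). G x) = (\<Sum>j\<leftarrow>js. \<Sum>x\<leftarrow>F j. G x)"
    for F :: "nat \<Rightarrow> (complex \<times> share) list" and js and G :: "complex \<times> share \<Rightarrow> rep_family"
    by (induction js) simp_all
  have "linear_op (rep P) M
      = (\<Sum>j\<leftarrow>[0..<Suc (degree P)]. \<Sum>i\<leftarrow>[0..<Suc (degree (coeff P j))].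
           scal [:coeff (coeff P j) i:] * transfer_op (Defs.mono i j) M)"
    unfolding linear_op_def rep_def conc map_map comp_def prod.case ..
  also have "\<dots> = (\<Sum>j<Suc (degree P). \<Sum>i<Suc (degree (coeff P j)).
      scal [:coeff (coeff P j) i:] * casimir ^ i * (bridge ^^ j) M)"
    unfolding upt transfer_op_mono mult.assoc ..
  also have "\<dots> = polyop P M"
    unfolding polyop_expand sum_distrib_right[symmetric] scal_expand[symmetric] ..
  finally show ?thesis .
qed

lemma share_sim_rep:
  "opU (rep P) \<sim>\<^sub>S rep Q \<longleftrightarrow> (\<forall>H. is_share H \<longrightarrow> pairing (opU_map (polyop P)) H = pairing (polyop Q) H)"
  "opX (rep P) \<sim>\<^sub>S rep Q \<longleftrightarrow> (\<forall>H. is_share H \<longrightarrow> pairing (opX_map (polyop P)) H = pairing (polyop Q) H)"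
  "opY (rep P) \<sim>\<^sub>S rep Q \<longleftrightarrow> (\<forall>H. is_share H \<longrightarrow> pairing (\<lambda>M. polyop P (bridge M)) H = pairing (polyop Q) H)"
proof -
  have eq: "linear_op (rep P) = polyop P" for P using linear_op_rep by (simp add: fun_eq_iff)
  have eqs: "linear_op (opU (rep P)) = opU_map (polyop P)" "linear_op (opX (rep P)) = opX_map (polyop P)"
    "linear_op (opY (rep P)) = (\<lambda>M. polyop P (bridge M))" for P
    by (simp_all add: fun_eq_iff linear_op_ops eq)
  show "opU (rep P) \<sim>\<^sub>S rep Q \<longleftrightarrow> (\<forall>H. is_share H \<longrightarrow> pairing (opU_map (polyop P)) H = pairing (polyop Q) H)"
    "opX (rep P) \<sim>\<^sub>S rep Q \<longleftrightarrow> (\<forall>H. is_share H \<longrightarrow> pairing (opX_map (polyop P)) H = pairing (polyop Q) H)"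
    "opY (rep P) \<sim>\<^sub>S rep Q \<longleftrightarrow> (\<forall>H. is_share H \<longrightarrow> pairing (\<lambda>M. polyop P (bridge M)) H = pairing (polyop Q) H)"
    using share_sim_iff[OF is_share_op_rep(1) is_share_rep] share_sim_iff[OF is_share_op_rep(2) is_share_rep]
      share_sim_iff[OF is_share_op_rep(3) is_share_rep] unfolding eq eqs by blast+
qed

section \<open>Nondegeneracy and the theorem\<close>

text \<open>In a join, a chord attached to the end of strand 1 of the first share can be regarded as
  part of the second share: \<open>Y\<close> becomes an arch around strand 1 of the test share,
  \<open>X\<close> a bridge between the beginnings of its strands.\<close>

lemma pairing_adjoint:
  assumes T: "invariant_map T" and N: "N \<notin> set P \<union> set Q"
  shows "pairing (\<lambda>M. T (bridge M)) (P, Q) = pairing T (N # P @ [N], Q)"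
    and "pairing (opX_map T) (P, Q) = pairing T (N # P, N # Q)"
proof -
  have set: "set (fst (N # P @ [N], Q)) \<union> set (snd (N # P @ [N], Q)) = insert N (set P \<union> set Q)"
    "set (fst (N # P, N # Q)) \<union> set (snd (N # P, N # Q)) = insert N (set P \<union> set Q)" by auto
  have N': "N \<notin> set P" "N \<notin> set Q" using N by auto
  show "pairing (\<lambda>M. T (bridge M)) (P, Q) = pairing T (N # P @ [N], Q)"
    unfolding pairing_def set colsum_insert[OF N] bridge_def invariant_map_sum[OF T] sum_distrib_right
      colsum_sum[symmetric]
    using N' by (auto intro!: sum.cong colsum_cong simp: mult.assoc)
  show "pairing (opX_map T) (P, Q) = pairing T (N # P, N # Q)"
    unfolding pairing_def set colsum_insert[OF N] opX_map_def sum_distrib_right colsum_sum[symmetric]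
    using N' by (auto intro!: sum.cong colsum_cong simp: mult.assoc)
qed

definition null_poly :: "complex poly poly \<Rightarrow> bool" where
  "null_poly P \<longleftrightarrow> (\<forall>H. is_share H \<longrightarrow> pairing (polyop P) H = 0)"

lemma pairing_polyop_diff: "pairing (polyop (P - Q)) H = pairing (polyop P) H - pairing (polyop Q) H"
  unfolding pairing_def polyop_diff left_diff_distrib colsum_diff ..

lemma pairing_polyop_smult: "pairing (polyop (smult p P)) H = scal p * pairing (polyop P) H"
  unfolding pairing_def polyop_smult mult.assoc colsum_mult_left ..

text \<open>Write \<open>U\<close> as \<open>c + X - Y\<close>; \<open>X\<close> and
  \<open>Y\<close> can be moved to the test share by \<open>pairing_adjoint\<close>, and the
  enlarged test object is again a share.\<close>

lemma null_poly_U: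
  assumes P: "null_poly P" and U: "U_image P V"
  shows "null_poly V"
  unfolding null_poly_def
proof (intro allI impI)
  fix H assume H: "is_share H"
  obtain A B where AB: "H = (A, B)" by (cases H)
  define N where "N = fresh H"
  have N: "N \<notin> set A \<union> set B" using fresh_notin[of H] by (simp add: N_def AB)
  have sh: "is_share (N # A @ [N], B)" "is_share (N # A, N # B)"
    using H unfolding AB by (rule is_share_add_chord[OF _ N]; simp)+
  have "polyop V = (\<lambda>M. casimir * polyop P M + opX_map (polyop P) M - polyop P (bridge M))"
    using U opU_map_eq[OF polyop_invariant, of P] unfolding U_image_def by (simp add: fun_eq_iff)
  hence "pairing (polyop V) H = casimir * pairing (polyop P) H + pairing (opX_map (polyop P)) H
      - pairing (\<lambda>M. polyop P (bridge M)) H"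
    unfolding pairing_lincomb[symmetric] by (simp add: pairing_def left_diff_distrib colsum_diff)
  thus "pairing (polyop V) H = 0"
    using P H sh unfolding AB pairing_adjoint[OF polyop_invariant N] null_poly_def by simp
qed

lemma poly_eig_casimir_nonzero: "poly (eig n) [:0, 1:] \<noteq> 0"
proof (induction n)
  case (Suc n)
  have "(of_nat n + 1 :: complex) = of_nat (Suc n)" "(2 * of_nat n + 1 :: complex) = of_nat (Suc (2 * n))" by simp_all
  hence "(of_nat n + 1) / (2 * of_nat n + 1) \<noteq> (0 :: complex)"
    by (simp only: divide_eq_0_iff of_nat_eq_0_iff) simp
  moreover have "c_minus z \<noteq> 0" for z by (simp add: c_minus_def)
  ultimately show ?case using Suc unfolding eig_ratio by (simp only: mult_eq_0_iff smult_eq_0_iff) simp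
qed simp

lemma u_diff: "u i - u j = [:of_nat (j * (j + 1)) / 2 - of_nat (i * (i + 1)) / 2:]"
  by (simp add: u_def c_minus_def)

lemma u_inject: "u i = u j \<longleftrightarrow> i = j"
proof
  assume "u i = u j"
  hence "of_nat (j * (j + 1)) = (of_nat (i * (i + 1)) :: complex)"
    using u_diff[of i j] by (simp del: of_nat_mult of_nat_add)
  hence "j * (j + 1) = i * (i + 1)" using of_nat_eq_iff by blast
  thus "i = j"
    using mult_strict_mono[of i j "i+1" "j+1"] mult_strict_mono[of j i "j+1" "i+1"]
    by (cases i j rule: linorder_cases) auto
qed simp

lemma smult_sum_right: "smult p (sum f S) = (\<Sum>x\<in>S. smult p (f x))"
  by (induction S rule: infinite_finite_induct) (simp_all add: smult_add_right)

lemma U_image_eig_sum: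
  "U_image (\<Sum>j\<in>S. smult (a j) (eig j)) (\<Sum>j\<in>S. smult (a j * u j) (eig j))"
proof (rule U_image_sum)
  fix j
  show "U_image (smult (a j) (eig j)) (smult (a j * u j) (eig j))"
    using U_image_smult[OF U_image_eig, of "a j" j] by simp
qed

text \<open>Applying \<open>U - u (Suc d)\<close> preserves nullity and kills the top term. By
  induction and distinctness of the eigenvalues all lower coefficients vanish, and the single
  remaining term is tested on the empty share.\<close>

lemma null_eig_sum:
  assumes "null_poly (\<Sum>j\<le>d. smult (a j) (eig j))" "j \<le> d"
  shows "a j = 0"
  using assms
proof (induction d arbitrary: a j)
  have top: "a d = 0" if "null_poly (smult (a d) (eig d))" for a d
  proof -
    \<comment> \<open>The empty share evaluates the operator at \<open>1\<close>, that is, the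
      polynomial at \<open>y = c\<close>, where \<open>eig d\<close> is nonzero.\<close>
    have "pairing (polyop (smult (a d) (eig d))) ([], []) = 0"
      using that unfolding null_poly_def by (simp add: is_share_def)
    hence "polyop (smult (a d) (eig d)) (scal 1) = 0" by (simp add: pairing_def colsum_empty)
    hence "scal (a d * poly (eig d) [:0, 1:]) = scal 0" unfolding polyop_scal by simp
    thus ?thesis unfolding scal_inject using poly_eig_casimir_nonzero by simp
  qed
  {
    case 0
    thus ?case using top[of a 0] by simp
  next
    case (Suc d)
    let ?P = "\<Sum>j\<le>Suc d. smult (a j) (eig j)"
    let ?V = "\<Sum>j\<le>Suc d. smult (a j * u j) (eig j)"
    have "null_poly (?V - smult (u (Suc d)) ?P)"
      using null_poly_U[OF Suc.prems(1) U_image_eig_sum] Suc.prems(1)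
      unfolding null_poly_def by (simp only: pairing_polyop_diff pairing_polyop_smult) simp
    also have "?V - smult (u (Suc d)) ?P = (\<Sum>j\<le>d. smult (a j * (u j - u (Suc d))) (eig j))"
    proof -
      have "?V - smult (u (Suc d)) ?P = (\<Sum>j\<le>Suc d. smult (a j * (u j - u (Suc d))) (eig j))"
        unfolding smult_sum_right sum_subtractf[symmetric]
        by (intro sum.cong refl) (simp only: smult_smult smult_diff_left right_diff_distrib mult.commute[of "u (Suc d)"])
      thus ?thesis by simp
    qed
    finally have null: "null_poly (\<Sum>j\<le>d. smult (a j * (u j - u (Suc d))) (eig j))" .
    have "a i * (u i - u (Suc d)) = 0" if "i \<le> d" for i by (rule Suc.IH[OF null that])
    hence zero: "a i = 0" if "i \<le> d" for i using that u_inject[of i "Suc d"] by fastforce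
    have "?P = smult (a (Suc d)) (eig (Suc d))" using zero by simp
    hence "a (Suc d) = 0" using top Suc.prems(1) by metis
    thus ?case using zero Suc.prems(2) by (cases "j = Suc d") auto
  }
qed

section \<open>The eigenvectors as a basis and the uniqueness of each\<close>

lemma eig_monic: "degree (eig n) \<le> n \<and> coeff (eig n) n = 1"
proof (induction n rule: eig.induct)
  case (3 n)
  have eq: "eig (Suc (Suc n)) = pCons 0 (eig (Suc n)) - (smult [:of_nat ((n + 1) * (n + 2)) / 4:] (eig (Suc n))
     + smult (coefK (Suc n)) (eig n))"
  proof -
    have "(y - b) * f - k * g = y * f - (b * f + k * g)" for y b f k g :: "complex poly poly"
      by (simp add: algebra_simps)
    note * = this
    show ?thesis unfolding eig.simps(3) * by simp
  qed
  have "degree (smult [:of_nat ((n + 1) * (n + 2)) / 4:] (eig (Suc n)) + smult (coefK (Suc n)) (eig n)) \<le> Suc n"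
    using 3 by (intro degree_add_le order_trans[OF degree_smult_le]) auto
  thus ?case unfolding eq using 3
    by (auto intro!: degree_diff_le order_trans[OF degree_pCons_le] simp: coeff_eq_0 simp del: coeff_add)
qed simp_all

lemma degree_eig: "degree (eig n) = n" and lead_coeff_eig: "lead_coeff (eig n) = 1"
proof -
  show "degree (eig n) = n" using eig_monic[of n] le_degree[of "eig n" n] by (intro antisym) auto
  thus "lead_coeff (eig n) = 1" using eig_monic[of n] by simp
qed

text \<open>Triangularity: subtracting a multiple of the monic \<open>eig\<close> of top index
  lowers the degree bound. The top coefficient is recorded because monicity of \<open>P\<close> must
  later fix it.\<close>

lemma eig_expansion:
  "degree P \<le> d \<Longrightarrow> \<exists>a. P = (\<Sum>j\<le>d. smult (a j) (eig j)) \<and> a d = coeff P d"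
proof (induction d arbitrary: P)
  case 0
  then obtain p where "P = [:p:]" using degree_0_id by (metis le_zero_eq)
  thus ?case by (intro exI[of _ "\<lambda>_. p"]) simp
next
  case (Suc d)
  let ?Q = "P - smult (coeff P (Suc d)) (eig (Suc d))"
  have "degree ?Q \<le> d"
  proof (intro degree_le allI impI)
    fix i assume "d < i"
    show "coeff ?Q i = 0"
    proof (cases "i = Suc d")
      case True
      thus ?thesis using eig_monic[of "Suc d"] by simp
    next
      case False
      hence "Suc d < i" using \<open>d < i\<close> by simp
      thus ?thesis using Suc.prems degree_eig[of "Suc d"] by (simp add: coeff_eq_0)
    qed
  qed
  from Suc.IH[OF this] obtain a where a: "?Q = (\<Sum>j\<le>d. smult (a j) (eig j))" by blast
  have "P = (\<Sum>j\<le>Suc d. smult ((a(Suc d := coeff P (Suc d))) j) (eig j))"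
    using a by (simp add: algebra_simps)
  thus ?case by (intro exI[of _ "a(Suc d := coeff P (Suc d))"]) simp
qed

lemma smult_conv: "smult p P = [:p:] * P" for P :: "complex poly poly"
  by simp

text \<open>For uniqueness, expand a candidate \<open>P\<close> in the \<open>eig j\<close>. The
  difference of \<open>U P\<close> and \<open>u m\<close> times \<open>P\<close> is null with
  coefficients \<open>a j * (u j - u m)\<close>, so \<open>a j = 0\<close> for \<open>j < m\<close>,
  and monicity gives \<open>a m = 1\<close>.\<close>

lemma e_eq_eig: "e m = eig m"
  unfolding e_def
proof (rule the_equality, intro conjI)
  show "degree (eig m) = m" "lead_coeff (eig m) = 1" by (fact degree_eig lead_coeff_eig)+
  show "opU (rep (eig m)) \<sim>\<^sub>S rep (smult (u m) (eig m))"
  proof -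
    have "opU_map (polyop (eig m)) = polyop (smult (u m) (eig m))"
      using U_image_eig[of m] unfolding U_image_def smult_conv by (simp only: fun_eq_iff) blast
    thus ?thesis unfolding share_sim_rep by simp
  qed
next
  fix P assume P: "degree P = m \<and> lead_coeff P = 1 \<and> opU (rep P) \<sim>\<^sub>S rep (smult (u m) P)"
  obtain a where a: "P = (\<Sum>j\<le>m. smult (a j) (eig j))" "a m = coeff P m"
    using eig_expansion[of P m] P by auto
  let ?V = "\<Sum>j\<le>m. smult (a j * u j) (eig j)"
  have "opU_map (polyop P) = polyop ?V"
    using U_image_eig_sum[of a "{..m}"] unfolding U_image_def a(1)[symmetric] by (simp only: fun_eq_iff) blast
  hence "null_poly (?V - smult (u m) P)"
    using P unfolding share_sim_rep null_poly_def pairing_polyop_diff by simp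
  also have "?V - smult (u m) P = (\<Sum>j\<le>m. smult (a j * (u j - u m)) (eig j))"
    unfolding a(1) smult_sum_right sum_subtractf[symmetric]
    by (intro sum.cong refl) (simp only: smult_smult smult_diff_left right_diff_distrib mult.commute[of "u m"])
  finally have null: "null_poly (\<Sum>j\<le>m. smult (a j * (u j - u m)) (eig j))" .
  have "a j * (u j - u m) = 0" if "j \<le> m" for j by (rule null_eig_sum[OF null that])
  hence zero: "a j = 0" if "j < m" for j
    using u_inject[of j m] that less_imp_le[OF that] by (metis mult_eq_0_iff right_minus_eq less_irrefl)
  have "P = (\<Sum>j\<le>m. if j = m then eig m else 0)"
    unfolding a(1) using zero a(2) P by (intro sum.cong) auto
  thus "P = eig m" by simp
qed

theorem theorem6:
  fixes n :: nat
  shows "opX (rep (e n)) \<sim>\<^sub>S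
           rep (e (n + 1) - smult [:of_nat (n * (n + 1)) / 4:] (e n) + smult (coefK n) (e_prev n))
       \<and> opY (rep (e n)) \<sim>\<^sub>S
           rep (e (n + 1) + smult [:of_nat (n * (n + 1)) / 4:] (e n) + smult (coefK n) (e_prev n))
       \<and> opU (rep (e n)) \<sim>\<^sub>S rep (smult (c_minus (of_nat (n * (n + 1)) / 2)) (e n))"
proof -
  let ?b = "[:of_nat (n * (n + 1)) / 4 :: complex:]"
  have prev: "e_prev n = (if n = 0 then 0 else eig (n - 1))" by (simp add: e_prev_def e_eq_eig)
  have Y: "polyop (eig n) (bridge M)
      = polyop (eig (n + 1) + smult ?b (eig n) + smult (coefK n) (e_prev n)) M" for M
    using eig_y[of n] unfolding prev smult_conv polyop_y_mult[symmetric] by (simp only:)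
  have U: "opU_map (polyop (eig n)) M = polyop (smult (u n) (eig n)) M" for M
    using U_image_eig[of n] unfolding U_image_def smult_conv by blast
  have X: "opX_map (polyop (eig n)) M
      = polyop (eig (n + 1) - smult ?b (eig n) + smult (coefK n) (e_prev n)) M" for M
  proof -
    \<comment> \<open>Since \<open>u n = c - 2 b\<close>, the relation \<open>X = U + Y - c\<close>
      changes the middle coefficient from \<open>b\<close> to \<open>- b\<close> and leaves the
      other two as they are for \<open>Y\<close>.\<close>
    have un: "u n = [:0, 1:] - ?b - ?b" by (simp add: u_def c_minus_def)
    have "opX_map (polyop (eig n)) M
      = opU_map (polyop (eig n)) M + polyop (eig n) (bridge M) - casimir * polyop (eig n) M"
      using opU_map_eq[OF polyop_invariant, of "eig n" M] by simp
    thus ?thesis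
      unfolding U Y un polyop_add polyop_diff polyop_smult scal_diff by (simp add: algebra_simps)
  qed
  show ?thesis
    unfolding e_eq_eig share_sim_rep ext[of "opX_map _", OF X] ext[of "\<lambda>M. polyop _ (bridge M)", OF Y]
      ext[of "opU_map _", OF U] u_def by simp
qed

end
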